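(* Let $\mathcal{L}=(L_i \mid i\in I)$ be a family of lattices, and $\varphi_i\colon L_i\to M$ a family of join-semilattice homomorphisms from the $L_i$ to a common lattice $M$. Suppose all $L_i$ lie in some prevariety $\mathbf{V}$ of lattices, and let $L=\mathrm{Free}_{\mathbf{D}\circ\mathbf{V}}\mathcal{L}$. Then there exists a join-semilattice homomorphism $\varphi\colon L\to M$ whose restrictions to the $L_i$ are the $\varphi_i$.
   Context: Lattices are nonempty. A join-semilattice homomorphism is a map preserving binary joins. A prevariety of lattices is a class of lattices closed under (isomorphic copies,) direct products and sublattices. $\mathbf{D}$ is the variety of distributive lattices. If $\mathbf{K}_1$ and $\mathbf{K}_2$ are classes of lattices, $\mathbf{K}_1\circ\mathbf{K}_2$ is the class of those lattices $N$ which admit a lattice homomorphism $\varepsilon\colon N\to N_2$ with $N_2\in\mathbf{K}_2$ such that the inverse image of every element of $N_2$ lies in $\mathbf{K}_1$ (an empty inverse image imposes no condition). If $\mathbf{K}_1,\mathbf{K}_2$ are prevarieties then so is $\mathbf{K}_1\circ\mathbf{K}_2$. For a prevariety $\mathbf{W}$ containing the $L_i$, $\mathrm{Free}_{\mathbf{W}}\mathcal{L}$ denotes the free product of the $L_i$ in $\mathbf{W}$: a lattice in $\mathbf{W}$ with lattice homomorphisms from the $L_i$ that is universal among families of lattice homomorphisms from the $L_i$ to a common lattice in $\mathbf{W}$ (the coproduct in $\mathbf{W}$). The canonical maps are embeddings, and each $L_i$ is identified with its image. *)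

theory Defs
  imports "HOL-Algebra.Lattice" "HOL-Library.FuncSet"
begin

text \<open>
  Lattices are the carrier-based lattices of \<open>HOL-Algebra\<close>, with nonempty carrier.

  A class of lattices is rendered as a set of lattice structures whose carriers are subsets of a
  fixed type \<open>'u\<close>, the universe.  It stands for the part of a proper class that consists of the
  lattices of size at most \<open>|'u|\<close>.
\<close>

definition nonempty_lattice :: "'a gorder \<Rightarrow> bool" where
  "nonempty_lattice L \<longleftrightarrow> lattice L \<and> carrier L \<noteq> {}"

definition join_hom :: "'a gorder \<Rightarrow> 'b gorder \<Rightarrow> ('a \<Rightarrow> 'b) \<Rightarrow> bool" where
  "join_hom X Y f \<longleftrightarrow> f \<in> carrier X \<rightarrow> carrier Y \<and> join_pres X Y f"

definition lattice_hom :: "'a gorder \<Rightarrow> 'b gorder \<Rightarrow> ('a \<Rightarrow> 'b) \<Rightarrow> bool" where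
  "lattice_hom X Y f \<longleftrightarrow> f \<in> carrier X \<rightarrow> carrier Y \<and> join_pres X Y f \<and> meet_pres X Y f"

definition direct_product :: "'j set \<Rightarrow> ('j \<Rightarrow> 'a gorder) \<Rightarrow> ('j \<Rightarrow> 'a) gorder" where
  "direct_product J F =
     \<lparr> carrier = (\<Pi>\<^sub>E j\<in>J. carrier (F j)),
       eq = (=),
       le = (\<lambda>f g. \<forall>j\<in>J. f j \<sqsubseteq>\<^bsub>F j\<^esub> g j) \<rparr>"

text \<open>
  A direct product of members of \<open>V\<close> need not fit into \<open>'u\<close> although some of its sublattices do.
  Closure under isomorphic copies, direct products and sublattices is therefore imposed in one
  step: every lattice on \<open>'u\<close> that is isomorphic to a sublattice of a direct product of members of
  \<open>V\<close> (that is, admits an injective lattice homomorphism into such a product) belongs to \<open>V\<close>.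
  The index type \<open>'u \<times> 'u\<close> is no restriction: see \<open>prevariety_closed\<close> below.  The empty index set
  is allowed.
\<close>

definition prevariety :: "'u gorder set \<Rightarrow> bool" where
  "prevariety V \<longleftrightarrow>
     (\<forall>N\<in>V. nonempty_lattice N) \<and>
     (\<forall>N (J :: ('u \<times> 'u) set) F h.
        nonempty_lattice N \<longrightarrow> (\<forall>j\<in>J. F j \<in> V) \<longrightarrow>
        lattice_hom N (direct_product J F) h \<longrightarrow> inj_on h (carrier N) \<longrightarrow> N \<in> V)"

definition distributive_lattices :: "'u gorder set" where
  "distributive_lattices =
     {N. nonempty_lattice N \<and>
         (\<forall>x\<in>carrier N. \<forall>y\<in>carrier N. \<forall>z\<in>carrier N.
            x \<sqinter>\<^bsub>N\<^esub> (y \<squnion>\<^bsub>N\<^esub> z) = (x \<sqinter>\<^bsub>N\<^esub> y) \<squnion>\<^bsub>N\<^esub> (x \<sqinter>\<^bsub>N\<^esub> z))}"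

definition class_comp :: "'u gorder set \<Rightarrow> 'u gorder set \<Rightarrow> 'u gorder set" where
  "class_comp K1 K2 =
     {N. nonempty_lattice N \<and>
         (\<exists>N2\<in>K2. \<exists>\<epsilon>. lattice_hom N N2 \<epsilon> \<and>
            (\<forall>y\<in>carrier N2. {x \<in> carrier N. \<epsilon> x = y} \<noteq> {} \<longrightarrow>
               N\<lparr>carrier := {x \<in> carrier N. \<epsilon> x = y}\<rparr> \<in> K1))}"

text \<open>
  \<open>(L, \<eta>)\<close> is the coproduct in \<open>W\<close> of the family \<open>(Ls i)\<close>, \<open>i \<in> I\<close>.  Testing universality on
  lattices in the universe loses nothing if \<open>'u\<close> is infinite and \<open>W\<close> contains a two-element
  lattice: the images \<open>\<eta> i ` carrier (Ls i)\<close> are then pairwise disjoint, so \<open>|I| \<le> |'u|\<close>, and in any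
  lattice the sublattice generated by homomorphic images of the \<open>Ls i\<close> has at most \<open>|'u|\<close> elements.
  Uniqueness of the induced map is up to its values outside the carrier of \<open>L\<close>.
\<close>

definition free_product_in ::
    "'u gorder set \<Rightarrow> 'i set \<Rightarrow> ('i \<Rightarrow> 'u gorder) \<Rightarrow> 'u gorder \<Rightarrow> ('i \<Rightarrow> 'u \<Rightarrow> 'u) \<Rightarrow> bool" where
  "free_product_in W I Ls L \<eta> \<longleftrightarrow>
     L \<in> W \<and> (\<forall>i\<in>I. lattice_hom (Ls i) L (\<eta> i)) \<and>
     (\<forall>N\<in>W. \<forall>\<psi>. (\<forall>i\<in>I. lattice_hom (Ls i) N (\<psi> i)) \<longrightarrow>
        (\<exists>!h. h \<in> extensional (carrier L) \<and> lattice_hom L N h \<and>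
              (\<forall>i\<in>I. \<forall>x\<in>carrier (Ls i). h (\<eta> i x) = \<psi> i x)))"


lemma join_eqI:
  assumes "partial_order L" "least L z (Upper L {x, y})"
  shows "x \<squnion>\<^bsub>L\<^esub> y = z"
proof -
  interpret partial_order L by fact
  show ?thesis
    unfolding join_def sup_def
    by (rule some_equality) (use assms(2) least_unique in blast)+
qed

lemma meet_eqI:
  assumes "partial_order L" "greatest L z (Lower L {x, y})"
  shows "x \<sqinter>\<^bsub>L\<^esub> y = z"
proof -
  interpret partial_order L by fact
  show ?thesis
    unfolding meet_def inf_def
    by (rule some_equality) (use assms(2) greatest_unique in blast)+
qed

lemma direct_product_lattice:
  assumes "\<And>j. j \<in> J \<Longrightarrow> lattice (F j)"
  shows "lattice (direct_product J F)"
    and "f \<in> carrier (direct_product J F) \<Longrightarrow> g \<in> carrier (direct_product J F) \<Longrightarrow>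
           f \<squnion>\<^bsub>direct_product J F\<^esub> g = (\<lambda>j\<in>J. f j \<squnion>\<^bsub>F j\<^esub> g j)"
    and "f \<in> carrier (direct_product J F) \<Longrightarrow> g \<in> carrier (direct_product J F) \<Longrightarrow>
           f \<sqinter>\<^bsub>direct_product J F\<^esub> g = (\<lambda>j\<in>J. f j \<sqinter>\<^bsub>F j\<^esub> g j)"
proof -
  let ?P = "direct_product J F"
  have wl: "weak_lattice (F j)" "partial_order (F j)" if "j \<in> J" for j
  proof -
    interpret lattice "F j" by (rule assms[OF that])
    show "weak_lattice (F j)" "partial_order (F j)" by unfold_locales
  qed
  note us = weak_lattice.axioms(1)[OF wl(1)] and ls = weak_lattice.axioms(2)[OF wl(1)]
  have carrierI: "(\<lambda>j\<in>J. f j) \<in> carrier ?P" if "\<And>j. j \<in> J \<Longrightarrow> f j \<in> carrier (F j)" for f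
    using that by (auto simp: direct_product_def)
  have le_iff: "f \<sqsubseteq>\<^bsub>?P\<^esub> g \<longleftrightarrow> (\<forall>j\<in>J. f j \<sqsubseteq>\<^bsub>F j\<^esub> g j)" for f g
    by (simp add: direct_product_def)
  have mem: "f j \<in> carrier (F j)" if "f \<in> carrier ?P" "j \<in> J" for f j
    using that by (auto simp: direct_product_def)
  have po: "partial_order ?P"
  proof
    fix x y z
    assume x: "x \<in> carrier ?P" and y: "y \<in> carrier ?P"
    show "x \<sqsubseteq>\<^bsub>?P\<^esub> x"
      unfolding le_iff
      using weak_partial_order.le_refl[OF partial_order.axioms(1)[OF wl(2)]] mem[OF x] by blast
    show "x .=\<^bsub>?P\<^esub> y" if "x \<sqsubseteq>\<^bsub>?P\<^esub> y" "y \<sqsubseteq>\<^bsub>?P\<^esub> x"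
    proof -
      have "x j = y j" if j: "j \<in> J" for j
        using partial_order.le_antisym[OF wl(2)[OF j]] mem[OF x j] mem[OF y j] j
          \<open>x \<sqsubseteq>\<^bsub>?P\<^esub> y\<close> \<open>y \<sqsubseteq>\<^bsub>?P\<^esub> x\<close> by (auto simp: direct_product_def)
      then show ?thesis
        using x y by (auto simp: direct_product_def intro: PiE_ext)
    qed
    show "x \<sqsubseteq>\<^bsub>?P\<^esub> z" if "x \<sqsubseteq>\<^bsub>?P\<^esub> y" "y \<sqsubseteq>\<^bsub>?P\<^esub> z" and z: "z \<in> carrier ?P"
    proof -
      have "x j \<sqsubseteq>\<^bsub>F j\<^esub> z j" if j: "j \<in> J" for j
        using weak_partial_order.le_trans[OF partial_order.axioms(1)[OF wl(2)[OF j]]]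
          mem[OF x j] mem[OF y j] mem[OF z j] j \<open>x \<sqsubseteq>\<^bsub>?P\<^esub> y\<close> \<open>y \<sqsubseteq>\<^bsub>?P\<^esub> z\<close>
        by (auto simp: direct_product_def)
      then show ?thesis by (simp add: direct_product_def)
    qed
  qed (auto simp: direct_product_def)
  have J: "least ?P (\<lambda>j\<in>J. f j \<squnion>\<^bsub>F j\<^esub> g j) (Upper ?P {f, g})"
    if f: "f \<in> carrier ?P" and g: "g \<in> carrier ?P" for f g
  proof -
    have c: "(\<lambda>j\<in>J. f j \<squnion>\<^bsub>F j\<^esub> g j) \<in> carrier ?P"
      by (intro carrierI weak_upper_semilattice.join_closed[OF us] mem[OF f] mem[OF g])
    show ?thesis
    proof (rule least_UpperI[OF _ _ _ c])
      show "x \<sqsubseteq>\<^bsub>?P\<^esub> (\<lambda>j\<in>J. f j \<squnion>\<^bsub>F j\<^esub> g j)" if "x \<in> {f, g}" for x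
        using that weak_upper_semilattice.join_left[OF us mem[OF f] mem[OF g]]
          weak_upper_semilattice.join_right[OF us mem[OF f] mem[OF g]]
        by (auto simp: le_iff)
      show "(\<lambda>j\<in>J. f j \<squnion>\<^bsub>F j\<^esub> g j) \<sqsubseteq>\<^bsub>?P\<^esub> y" if y: "y \<in> Upper ?P {f, g}" for y
      proof -
        have yc: "y \<in> carrier ?P" "f \<sqsubseteq>\<^bsub>?P\<^esub> y" "g \<sqsubseteq>\<^bsub>?P\<^esub> y"
          using y f g by (auto simp: Upper_def)
        have "f j \<squnion>\<^bsub>F j\<^esub> g j \<sqsubseteq>\<^bsub>F j\<^esub> y j" if j: "j \<in> J" for j
          using weak_upper_semilattice.join_le[OF us[OF j]]
            mem[OF f j] mem[OF g j] mem[OF yc(1) j] yc(2,3) j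
          by (auto simp: direct_product_def)
        then show ?thesis by (simp add: direct_product_def)
      qed
    qed (use f g in auto)
  qed
  have M: "greatest ?P (\<lambda>j\<in>J. f j \<sqinter>\<^bsub>F j\<^esub> g j) (Lower ?P {f, g})"
    if f: "f \<in> carrier ?P" and g: "g \<in> carrier ?P" for f g
  proof -
    have c: "(\<lambda>j\<in>J. f j \<sqinter>\<^bsub>F j\<^esub> g j) \<in> carrier ?P"
      by (intro carrierI weak_lower_semilattice.meet_closed[OF ls] mem[OF f] mem[OF g])
    show ?thesis
    proof (rule greatest_LowerI[OF _ _ _ c])
      show "(\<lambda>j\<in>J. f j \<sqinter>\<^bsub>F j\<^esub> g j) \<sqsubseteq>\<^bsub>?P\<^esub> x" if "x \<in> {f, g}" for x
        using that weak_lower_semilattice.meet_left[OF ls mem[OF f] mem[OF g]]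
          weak_lower_semilattice.meet_right[OF ls mem[OF f] mem[OF g]]
        by (auto simp: le_iff)
      show "y \<sqsubseteq>\<^bsub>?P\<^esub> (\<lambda>j\<in>J. f j \<sqinter>\<^bsub>F j\<^esub> g j)" if y: "y \<in> Lower ?P {f, g}" for y
      proof -
        have yc: "y \<in> carrier ?P" "y \<sqsubseteq>\<^bsub>?P\<^esub> f" "y \<sqsubseteq>\<^bsub>?P\<^esub> g"
          using y f g by (auto simp: Lower_def)
        have "y j \<sqsubseteq>\<^bsub>F j\<^esub> f j \<sqinter>\<^bsub>F j\<^esub> g j" if j: "j \<in> J" for j
          using weak_lower_semilattice.meet_le[OF ls[OF j]]
            mem[OF f j] mem[OF g j] mem[OF yc(1) j] yc(2,3) j
          by (auto simp: direct_product_def)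
        then show ?thesis by (simp add: direct_product_def)
      qed
    qed (use f g in auto)
  qed
  interpret P: partial_order ?P by (rule po)
  show "lattice ?P"
    by unfold_locales (use J M in blast)+
  show "f \<squnion>\<^bsub>?P\<^esub> g = (\<lambda>j\<in>J. f j \<squnion>\<^bsub>F j\<^esub> g j)" if "f \<in> carrier ?P" "g \<in> carrier ?P"
    using join_eqI[OF po J] that by blast
  show "f \<sqinter>\<^bsub>?P\<^esub> g = (\<lambda>j\<in>J. f j \<sqinter>\<^bsub>F j\<^esub> g j)" if "f \<in> carrier ?P" "g \<in> carrier ?P"
    using meet_eqI[OF po M] that by blast
qed

lemma lattice_hom_product_iff:
  fixes N :: "'a gorder" and F :: "'j \<Rightarrow> 'b gorder"
  assumes N: "lattice N" and F: "\<And>j. j \<in> J \<Longrightarrow> lattice (F j)"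
    and ext: "\<And>x. x \<in> carrier N \<Longrightarrow> h x \<in> extensional J"
  shows "lattice_hom N (direct_product J F) h \<longleftrightarrow> (\<forall>j\<in>J. lattice_hom N (F j) (\<lambda>x. h x j))"
proof -
  let ?P = "direct_product J F"
  interpret lattice N by (rule N)
  have fun_iff: "h \<in> carrier N \<rightarrow> carrier ?P \<longleftrightarrow> (\<forall>j\<in>J. (\<lambda>x. h x j) \<in> carrier N \<rightarrow> carrier (F j))"
    using ext by (auto simp: direct_product_def PiE_iff Pi_iff)
  have eq_iff: "h (x \<squnion>\<^bsub>N\<^esub> y) = h x \<squnion>\<^bsub>?P\<^esub> h y \<longleftrightarrow> (\<forall>j\<in>J. h (x \<squnion>\<^bsub>N\<^esub> y) j = h x j \<squnion>\<^bsub>F j\<^esub> h y j)"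
    "h (x \<sqinter>\<^bsub>N\<^esub> y) = h x \<sqinter>\<^bsub>?P\<^esub> h y \<longleftrightarrow> (\<forall>j\<in>J. h (x \<sqinter>\<^bsub>N\<^esub> y) j = h x j \<sqinter>\<^bsub>F j\<^esub> h y j)"
    if h: "h \<in> carrier N \<rightarrow> carrier ?P" and x: "x \<in> carrier N" and y: "y \<in> carrier N" for x y
  proof -
    have xy: "h x \<in> carrier ?P" "h y \<in> carrier ?P" using h x y by auto
    have e: "h (x \<squnion>\<^bsub>N\<^esub> y) \<in> extensional J" "h (x \<sqinter>\<^bsub>N\<^esub> y) \<in> extensional J"
      using ext x y by auto
    have J: "h x \<squnion>\<^bsub>?P\<^esub> h y = (\<lambda>j\<in>J. h x j \<squnion>\<^bsub>F j\<^esub> h y j)"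
      by (rule direct_product_lattice(2)[OF _ xy]) (rule F)
    have M: "h x \<sqinter>\<^bsub>?P\<^esub> h y = (\<lambda>j\<in>J. h x j \<sqinter>\<^bsub>F j\<^esub> h y j)"
      by (rule direct_product_lattice(3)[OF _ xy]) (rule F)
    have r: "u = restrict g J \<longleftrightarrow> (\<forall>j\<in>J. u j = g j)" if "u \<in> extensional J" for u g :: "'j \<Rightarrow> 'b"
      using that by (auto simp: restrict_def extensional_def fun_eq_iff)
    show "h (x \<squnion>\<^bsub>N\<^esub> y) = h x \<squnion>\<^bsub>?P\<^esub> h y \<longleftrightarrow> (\<forall>j\<in>J. h (x \<squnion>\<^bsub>N\<^esub> y) j = h x j \<squnion>\<^bsub>F j\<^esub> h y j)"
      unfolding J by (rule r[OF e(1)])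
    show "h (x \<sqinter>\<^bsub>N\<^esub> y) = h x \<sqinter>\<^bsub>?P\<^esub> h y \<longleftrightarrow> (\<forall>j\<in>J. h (x \<sqinter>\<^bsub>N\<^esub> y) j = h x j \<sqinter>\<^bsub>F j\<^esub> h y j)"
      unfolding M by (rule r[OF e(2)])
  qed
  have P: "lattice ?P" by (rule direct_product_lattice(1)) (rule F)
  show ?thesis
  proof (cases "h \<in> carrier N \<rightarrow> carrier ?P")
    case True
    have "lattice_hom N ?P h \<longleftrightarrow>
        (\<forall>x\<in>carrier N. \<forall>y\<in>carrier N.
          (\<forall>j\<in>J. h (x \<squnion>\<^bsub>N\<^esub> y) j = h x j \<squnion>\<^bsub>F j\<^esub> h y j) \<and>
          (\<forall>j\<in>J. h (x \<sqinter>\<^bsub>N\<^esub> y) j = h x j \<sqinter>\<^bsub>F j\<^esub> h y j))"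
      unfolding lattice_hom_def join_pres_def meet_pres_def using True N P eq_iff[OF True] by auto
    also have "\<dots> \<longleftrightarrow> (\<forall>j\<in>J. lattice_hom N (F j) (\<lambda>x. h x j))"
      unfolding lattice_hom_def join_pres_def meet_pres_def
      using fun_iff True N F by blast
    finally show ?thesis .
  next
    case False
    then have "\<not> (\<forall>j\<in>J. lattice_hom N (F j) (\<lambda>x. h x j))"
      using fun_iff by (auto simp: lattice_hom_def)
    with False show ?thesis by (simp add: lattice_hom_def)
  qed
qed

lemma prevariety_closed:
  fixes V :: "'u gorder set" and F :: "'j \<Rightarrow> 'u gorder"
  assumes V: "prevariety V" and N: "nonempty_lattice N" and F: "\<And>j. j \<in> J \<Longrightarrow> F j \<in> V"
    and h: "lattice_hom N (direct_product J F) h" and inj: "inj_on h (carrier N)"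
  shows "N \<in> V"
proof -
  have FL: "lattice (F j)" if "j \<in> J" for j
    using V[unfolded prevariety_def, THEN conjunct1] F[OF that] by (simp add: nonempty_lattice_def)
  have NL: "lattice N" using N by (simp add: nonempty_lattice_def)
  have hext: "h x \<in> extensional J" if "x \<in> carrier N" for x
    using h that by (auto simp: lattice_hom_def direct_product_def PiE_iff)
  define K where "K = {(a, b). a \<in> carrier N \<and> b \<in> carrier N \<and> a \<noteq> b}"
  have "\<exists>j\<in>J. h (fst p) j \<noteq> h (snd p) j" if "p \<in> K" for p
  proof (rule ccontr)
    assume *: "\<not> ?thesis"
    have "h (fst p) = h (snd p)"
      by (rule extensionalityI[of _ J]) (use * hext that in \<open>auto simp: K_def\<close>)
    then have "fst p = snd p"
      by (rule inj_onD[OF inj]) (use that in \<open>auto simp: K_def\<close>)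
    with that show False by (auto simp: K_def)
  qed
  then obtain j where j: "\<And>p. p \<in> K \<Longrightarrow> j p \<in> J \<and> h (fst p) (j p) \<noteq> h (snd p) (j p)"
    by metis
  define h' where "h' x = (\<lambda>p\<in>K. h x (j p))" for x
  have hj: "lattice_hom N (F k) (\<lambda>x. h x k)" if "k \<in> J" for k
    using lattice_hom_product_iff[where J = J and F = F and h = h, OF NL] FL hext h that by blast
  have "lattice_hom N (direct_product K (F \<circ> j)) h' \<longleftrightarrow>
      (\<forall>p\<in>K. lattice_hom N ((F \<circ> j) p) (\<lambda>x. h' x p))"
    by (rule lattice_hom_product_iff[OF NL]) (use FL j in \<open>auto simp: h'_def\<close>)
  then have "lattice_hom N (direct_product K (F \<circ> j)) h'"
    using hj j by (simp add: h'_def)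
  moreover have "inj_on h' (carrier N)"
  proof (rule inj_onI, rule ccontr)
    fix a b assume ab: "a \<in> carrier N" "b \<in> carrier N" "h' a = h' b" "a \<noteq> b"
    then have "(a, b) \<in> K" by (simp add: K_def)
    with j[OF this] fun_cong[OF ab(3), of "(a, b)"] show False by (simp add: h'_def)
  qed
  moreover have "\<forall>p\<in>K. (F \<circ> j) p \<in> V" using j F by auto
  ultimately show ?thesis
    using V[unfolded prevariety_def, THEN conjunct2, rule_format, OF N] by blast
qed

end

theory Submission
  imports Defs
begin

text \<open>
  By the universal property it suffices to find one lattice \<open>N\<close> in \<open>D \<circ> V\<close>, with homomorphisms from the
  \<open>L\<^sub>i\<close>, to which the \<open>\<phi>\<^sub>i\<close> extend.  An element of \<open>N\<close> is a pair \<open>(a, D)\<close>.  Here \<open>a\<close> lies in the product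
  \<open>A\<close> of copies of the \<open>L\<^sub>i\<close>, one for each \<open>i\<close> and each \<open>c\<close> in \<open>L\<^sub>i\<close>; in that coordinate \<open>L\<^sub>i\<close> maps by the
  identity and every other \<open>L\<^sub>j\<close> by the constant \<open>c\<close>.  The set \<open>D\<close> is a finitely generated downset of formal
  meets of elements of distinct \<open>L\<^sub>i\<close>, and \<open>a\<close> determines which elements of \<open>L\<^sub>i\<close> may occur in \<open>D\<close>: none,
  or those below the value that the coordinates \<open>(i, c)\<close> of \<open>a\<close> take for all small \<open>c\<close>.  Joins are unions
  of downsets, except that elements of the same \<open>L\<^sub>i\<close> are joined in \<open>L\<^sub>i\<close>.  Over a fixed \<open>a\<close> this exception
  adds nothing, so the fibers of \<open>N \<rightarrow> A\<close> are distributive; and sending \<open>(a, D)\<close> to the supremum in \<open>M\<close> of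
  the values of the formal meets in \<open>D\<close> preserves joins, since each \<open>\<phi>\<^sub>i\<close> does.
\<close>

section \<open>Lattices, copies and generated sublattices\<close>

text \<open>\<open>join\<close> and \<open>meet\<close> are choice terms depending on the order, so
  concrete operations must first be recognized as bounds; uniqueness of bounds then identifies them.
  Sublattices, copies and the lattice of pairs below are all treated this way.\<close>

lemma lattice_by_operations:
  fixes X :: "'a gorder"
  assumes eq: "eq X = (=)"
    and refl: "\<And>x. x \<in> carrier X \<Longrightarrow> x \<sqsubseteq>\<^bsub>X\<^esub> x"
    and antisym: "\<And>x y. \<lbrakk>x \<in> carrier X; y \<in> carrier X; x \<sqsubseteq>\<^bsub>X\<^esub> y; y \<sqsubseteq>\<^bsub>X\<^esub> x\<rbrakk> \<Longrightarrow> x = y"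
    and trans: "\<And>x y z. \<lbrakk>x \<in> carrier X; y \<in> carrier X; z \<in> carrier X; x \<sqsubseteq>\<^bsub>X\<^esub> y; y \<sqsubseteq>\<^bsub>X\<^esub> z\<rbrakk>
      \<Longrightarrow> x \<sqsubseteq>\<^bsub>X\<^esub> z"
    and j: "\<And>x y. \<lbrakk>x \<in> carrier X; y \<in> carrier X\<rbrakk> \<Longrightarrow> j x y \<in> carrier X \<and> x \<sqsubseteq>\<^bsub>X\<^esub> j x y \<and> y \<sqsubseteq>\<^bsub>X\<^esub> j x y"
      "\<And>x y z. \<lbrakk>x \<in> carrier X; y \<in> carrier X; z \<in> carrier X; x \<sqsubseteq>\<^bsub>X\<^esub> z; y \<sqsubseteq>\<^bsub>X\<^esub> z\<rbrakk>
        \<Longrightarrow> j x y \<sqsubseteq>\<^bsub>X\<^esub> z"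
    and m: "\<And>x y. \<lbrakk>x \<in> carrier X; y \<in> carrier X\<rbrakk> \<Longrightarrow> m x y \<in> carrier X \<and> m x y \<sqsubseteq>\<^bsub>X\<^esub> x \<and> m x y \<sqsubseteq>\<^bsub>X\<^esub> y"
      "\<And>x y z. \<lbrakk>x \<in> carrier X; y \<in> carrier X; z \<in> carrier X; z \<sqsubseteq>\<^bsub>X\<^esub> x; z \<sqsubseteq>\<^bsub>X\<^esub> y\<rbrakk>
        \<Longrightarrow> z \<sqsubseteq>\<^bsub>X\<^esub> m x y"
  shows "lattice X"
    and "\<And>x y. \<lbrakk>x \<in> carrier X; y \<in> carrier X\<rbrakk> \<Longrightarrow> x \<squnion>\<^bsub>X\<^esub> y = j x y"
    and "\<And>x y. \<lbrakk>x \<in> carrier X; y \<in> carrier X\<rbrakk> \<Longrightarrow> x \<sqinter>\<^bsub>X\<^esub> y = m x y"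
proof -
  have po: "partial_order X"
  proof
    show "x \<sqsubseteq>\<^bsub>X\<^esub> z \<longleftrightarrow> y \<sqsubseteq>\<^bsub>X\<^esub> w" if "x .=\<^bsub>X\<^esub> y" "z .=\<^bsub>X\<^esub> w" for x y z w
      using that by (simp add: eq)
    show "x \<sqsubseteq>\<^bsub>X\<^esub> z"
      if "x \<sqsubseteq>\<^bsub>X\<^esub> y" "y \<sqsubseteq>\<^bsub>X\<^esub> z" "x \<in> carrier X" "y \<in> carrier X" "z \<in> carrier X" for x y z
      using trans that by blast
  qed (simp_all add: eq refl antisym)
  have J: "least X (j x y) (Upper X {x, y})" if "x \<in> carrier X" "y \<in> carrier X" for x y
    using j(1)[OF that] j(2)[OF that] that by (auto simp: least_def Upper_def)
  have M: "greatest X (m x y) (Lower X {x, y})" if "x \<in> carrier X" "y \<in> carrier X" for x y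
    using m(1)[OF that] m(2)[OF that] that by (auto simp: greatest_def Lower_def)
  interpret partial_order X by (rule po)
  show "lattice X"
    by unfold_locales (use J M in blast)+
  show "x \<squnion>\<^bsub>X\<^esub> y = j x y" if "x \<in> carrier X" "y \<in> carrier X" for x y
    using join_eqI[OF po J[OF that]] .
  show "x \<sqinter>\<^bsub>X\<^esub> y = m x y" if "x \<in> carrier X" "y \<in> carrier X" for x y
    using meet_eqI[OF po M[OF that]] .
qed

lemma lattice_eq: "lattice X \<Longrightarrow> eq X = (=)"
  by (simp add: lattice_def upper_semilattice_def partial_order.eq_is_equal)

text \<open>The locale facts are restated with \<open>lattice X\<close> as an explicit premise,
  since many lattices, among them a family indexed by \<open>i\<close>, occur side by side.\<close>

lemma lattice_le:
  assumes "lattice X"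
  shows "x \<in> carrier X \<Longrightarrow> x \<sqsubseteq>\<^bsub>X\<^esub> x"
    and "\<lbrakk>x \<in> carrier X; y \<in> carrier X; x \<sqsubseteq>\<^bsub>X\<^esub> y; y \<sqsubseteq>\<^bsub>X\<^esub> x\<rbrakk> \<Longrightarrow> x = y"
    and "\<lbrakk>x \<in> carrier X; y \<in> carrier X; z \<in> carrier X; x \<sqsubseteq>\<^bsub>X\<^esub> y; y \<sqsubseteq>\<^bsub>X\<^esub> z\<rbrakk> \<Longrightarrow> x \<sqsubseteq>\<^bsub>X\<^esub> z"
proof -
  interpret lattice X by fact
  show "x \<in> carrier X \<Longrightarrow> x \<sqsubseteq>\<^bsub>X\<^esub> x" by simp
  show "\<lbrakk>x \<in> carrier X; y \<in> carrier X; x \<sqsubseteq>\<^bsub>X\<^esub> y; y \<sqsubseteq>\<^bsub>X\<^esub> x\<rbrakk> \<Longrightarrow> x = y"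
    by (rule le_antisym)
  show "\<lbrakk>x \<in> carrier X; y \<in> carrier X; z \<in> carrier X; x \<sqsubseteq>\<^bsub>X\<^esub> y; y \<sqsubseteq>\<^bsub>X\<^esub> z\<rbrakk> \<Longrightarrow> x \<sqsubseteq>\<^bsub>X\<^esub> z"
    by (rule le_trans)
qed

lemma lattice_join:
  assumes "lattice X"
  shows "\<lbrakk>x \<in> carrier X; y \<in> carrier X\<rbrakk> \<Longrightarrow> x \<squnion>\<^bsub>X\<^esub> y \<in> carrier X"
    and "\<lbrakk>x \<in> carrier X; y \<in> carrier X\<rbrakk> \<Longrightarrow> x \<sqsubseteq>\<^bsub>X\<^esub> x \<squnion>\<^bsub>X\<^esub> y"
    and "\<lbrakk>x \<in> carrier X; y \<in> carrier X\<rbrakk> \<Longrightarrow> y \<sqsubseteq>\<^bsub>X\<^esub> x \<squnion>\<^bsub>X\<^esub> y"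
    and "\<lbrakk>x \<in> carrier X; y \<in> carrier X; z \<in> carrier X; x \<sqsubseteq>\<^bsub>X\<^esub> z; y \<sqsubseteq>\<^bsub>X\<^esub> z\<rbrakk> \<Longrightarrow> x \<squnion>\<^bsub>X\<^esub> y \<sqsubseteq>\<^bsub>X\<^esub> z"
proof -
  interpret lattice X by fact
  show "\<lbrakk>x \<in> carrier X; y \<in> carrier X\<rbrakk> \<Longrightarrow> x \<squnion>\<^bsub>X\<^esub> y \<in> carrier X" by (rule join_closed)
  show "\<lbrakk>x \<in> carrier X; y \<in> carrier X\<rbrakk> \<Longrightarrow> x \<sqsubseteq>\<^bsub>X\<^esub> x \<squnion>\<^bsub>X\<^esub> y" by (rule join_left)
  show "\<lbrakk>x \<in> carrier X; y \<in> carrier X\<rbrakk> \<Longrightarrow> y \<sqsubseteq>\<^bsub>X\<^esub> x \<squnion>\<^bsub>X\<^esub> y" by (rule join_right)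
  show "\<lbrakk>x \<in> carrier X; y \<in> carrier X; z \<in> carrier X; x \<sqsubseteq>\<^bsub>X\<^esub> z; y \<sqsubseteq>\<^bsub>X\<^esub> z\<rbrakk> \<Longrightarrow> x \<squnion>\<^bsub>X\<^esub> y \<sqsubseteq>\<^bsub>X\<^esub> z"
    by (rule join_le)
qed

lemma lattice_meet:
  assumes "lattice X"
  shows "\<lbrakk>x \<in> carrier X; y \<in> carrier X\<rbrakk> \<Longrightarrow> x \<sqinter>\<^bsub>X\<^esub> y \<in> carrier X"
    and "\<lbrakk>x \<in> carrier X; y \<in> carrier X\<rbrakk> \<Longrightarrow> x \<sqinter>\<^bsub>X\<^esub> y \<sqsubseteq>\<^bsub>X\<^esub> x"
    and "\<lbrakk>x \<in> carrier X; y \<in> carrier X\<rbrakk> \<Longrightarrow> x \<sqinter>\<^bsub>X\<^esub> y \<sqsubseteq>\<^bsub>X\<^esub> y"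
    and "\<lbrakk>x \<in> carrier X; y \<in> carrier X; z \<in> carrier X; z \<sqsubseteq>\<^bsub>X\<^esub> x; z \<sqsubseteq>\<^bsub>X\<^esub> y\<rbrakk> \<Longrightarrow> z \<sqsubseteq>\<^bsub>X\<^esub> x \<sqinter>\<^bsub>X\<^esub> y"
proof -
  interpret lattice X by fact
  show "\<lbrakk>x \<in> carrier X; y \<in> carrier X\<rbrakk> \<Longrightarrow> x \<sqinter>\<^bsub>X\<^esub> y \<in> carrier X" by (rule meet_closed)
  show "\<lbrakk>x \<in> carrier X; y \<in> carrier X\<rbrakk> \<Longrightarrow> x \<sqinter>\<^bsub>X\<^esub> y \<sqsubseteq>\<^bsub>X\<^esub> x" by (rule meet_left)
  show "\<lbrakk>x \<in> carrier X; y \<in> carrier X\<rbrakk> \<Longrightarrow> x \<sqinter>\<^bsub>X\<^esub> y \<sqsubseteq>\<^bsub>X\<^esub> y" by (rule meet_right)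
  show "\<lbrakk>x \<in> carrier X; y \<in> carrier X; z \<in> carrier X; z \<sqsubseteq>\<^bsub>X\<^esub> x; z \<sqsubseteq>\<^bsub>X\<^esub> y\<rbrakk> \<Longrightarrow> z \<sqsubseteq>\<^bsub>X\<^esub> x \<sqinter>\<^bsub>X\<^esub> y"
    by (rule meet_le)
qed

lemma join_absorb:
  assumes X: "lattice X" and xy: "x \<in> carrier X" "y \<in> carrier X" "x \<sqsubseteq>\<^bsub>X\<^esub> y"
  shows "x \<squnion>\<^bsub>X\<^esub> y = y" "y \<squnion>\<^bsub>X\<^esub> x = y"
proof -
  have "x \<squnion>\<^bsub>X\<^esub> y \<sqsubseteq>\<^bsub>X\<^esub> y"
    by (rule lattice_join(4)[OF X xy(1,2,2,3) lattice_le(1)[OF X xy(2)]])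
  then show "x \<squnion>\<^bsub>X\<^esub> y = y"
    by (rule lattice_le(2)[OF X lattice_join(1)[OF X xy(1,2)] xy(2) _ lattice_join(3)[OF X xy(1,2)]])
  then show "y \<squnion>\<^bsub>X\<^esub> x = y" by (simp add: join_comm)
qed

lemma join_idem: "lattice X \<Longrightarrow> x \<in> carrier X \<Longrightarrow> x \<squnion>\<^bsub>X\<^esub> x = x"
  by (simp add: join_absorb(1) lattice_le(1))

lemma meet_absorb:
  assumes X: "lattice X" and xy: "x \<in> carrier X" "y \<in> carrier X" "x \<sqsubseteq>\<^bsub>X\<^esub> y"
  shows "x \<sqinter>\<^bsub>X\<^esub> y = x"
proof -
  have "x \<sqsubseteq>\<^bsub>X\<^esub> x \<sqinter>\<^bsub>X\<^esub> y"
    by (rule lattice_meet(4)[OF X xy(1,2,1) lattice_le(1)[OF X xy(1)] xy(3)])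
  then show "x \<sqinter>\<^bsub>X\<^esub> y = x"
    by (rule lattice_le(2)[OF X lattice_meet(1)[OF X xy(1,2)] xy(1) lattice_meet(2)[OF X xy(1,2)]])
qed

lemma meet_idem: "lattice X \<Longrightarrow> x \<in> carrier X \<Longrightarrow> x \<sqinter>\<^bsub>X\<^esub> x = x"
  by (simp add: meet_absorb lattice_le(1))

section \<open>Sublattices and homomorphisms\<close>

definition lattice_closed :: "'a gorder \<Rightarrow> 'a set \<Rightarrow> bool" where
  "lattice_closed X S \<longleftrightarrow> S \<subseteq> carrier X \<and>
     (\<forall>x\<in>S. \<forall>y\<in>S. x \<squnion>\<^bsub>X\<^esub> y \<in> S \<and> x \<sqinter>\<^bsub>X\<^esub> y \<in> S)"

lemma sublattice:
  fixes X :: "'a gorder"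
  assumes X: "lattice X" and S: "lattice_closed X S"
  shows "lattice (X\<lparr>carrier := S\<rparr>)"
    and "\<And>x y. \<lbrakk>x \<in> S; y \<in> S\<rbrakk> \<Longrightarrow> x \<squnion>\<^bsub>X\<lparr>carrier := S\<rparr>\<^esub> y = x \<squnion>\<^bsub>X\<^esub> y"
    and "\<And>x y. \<lbrakk>x \<in> S; y \<in> S\<rbrakk> \<Longrightarrow> x \<sqinter>\<^bsub>X\<lparr>carrier := S\<rparr>\<^esub> y = x \<sqinter>\<^bsub>X\<^esub> y"
proof -
  let ?Y = "X\<lparr>carrier := S\<rparr>"
  note facts = lattice_le(1)[OF X] lattice_join[OF X] lattice_meet[OF X]
  have in_X: "x \<in> carrier X" if "x \<in> S" for x
    using S that by (auto simp: lattice_closed_def)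
  have j: "x \<squnion>\<^bsub>X\<^esub> y \<in> S" and m: "x \<sqinter>\<^bsub>X\<^esub> y \<in> S" if "x \<in> S" "y \<in> S" for x y
    using S that by (auto simp: lattice_closed_def)
  have eq: "eq ?Y = (=)" using lattice_eq[OF X] by simp
  have antisym: "x = y" if "x \<in> carrier ?Y" "y \<in> carrier ?Y" "x \<sqsubseteq>\<^bsub>?Y\<^esub> y" "y \<sqsubseteq>\<^bsub>?Y\<^esub> x" for x y
    using lattice_le(2)[OF X, of x y] that in_X by simp
  have trans: "x \<sqsubseteq>\<^bsub>?Y\<^esub> z" if "x \<in> carrier ?Y" "y \<in> carrier ?Y" "z \<in> carrier ?Y" "x \<sqsubseteq>\<^bsub>?Y\<^esub> y" "y \<sqsubseteq>\<^bsub>?Y\<^esub> z"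
    for x y z
    using lattice_le(3)[OF X, of x y z] that in_X by simp
  note ops = lattice_by_operations[where X = ?Y and j = "join X" and m = "meet X", OF eq]
  show "lattice ?Y"
    by (rule ops(1)) ((rule antisym trans; assumption) | simp add: in_X j m facts)+
  show "x \<squnion>\<^bsub>?Y\<^esub> y = x \<squnion>\<^bsub>X\<^esub> y" if "x \<in> S" "y \<in> S" for x y
    by (rule ops(2)) ((rule antisym trans; assumption) | simp add: that in_X j m facts)+
  show "x \<sqinter>\<^bsub>?Y\<^esub> y = x \<sqinter>\<^bsub>X\<^esub> y" if "x \<in> S" "y \<in> S" for x y
    by (rule ops(3)) ((rule antisym trans; assumption) | simp add: that in_X j m facts)+
qed

lemma lattice_homI:
  assumes "lattice X" "lattice Y" "\<And>x. x \<in> carrier X \<Longrightarrow> f x \<in> carrier Y"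
    and "\<And>x y. \<lbrakk>x \<in> carrier X; y \<in> carrier X\<rbrakk> \<Longrightarrow> f (x \<squnion>\<^bsub>X\<^esub> y) = f x \<squnion>\<^bsub>Y\<^esub> f y"
    and "\<And>x y. \<lbrakk>x \<in> carrier X; y \<in> carrier X\<rbrakk> \<Longrightarrow> f (x \<sqinter>\<^bsub>X\<^esub> y) = f x \<sqinter>\<^bsub>Y\<^esub> f y"
  shows "lattice_hom X Y f"
  using assms by (auto simp: lattice_hom_def join_pres_def meet_pres_def)

lemma lattice_homD:
  assumes "lattice_hom X Y f"
  shows "lattice X" "lattice Y" "x \<in> carrier X \<Longrightarrow> f x \<in> carrier Y"
    and "\<lbrakk>x \<in> carrier X; y \<in> carrier X\<rbrakk> \<Longrightarrow> f (x \<squnion>\<^bsub>X\<^esub> y) = f x \<squnion>\<^bsub>Y\<^esub> f y"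
    and "\<lbrakk>x \<in> carrier X; y \<in> carrier X\<rbrakk> \<Longrightarrow> f (x \<sqinter>\<^bsub>X\<^esub> y) = f x \<sqinter>\<^bsub>Y\<^esub> f y"
  using assms by (auto simp: lattice_hom_def join_pres_def meet_pres_def)

lemma join_homI:
  assumes "lattice X" "lattice Y" "\<And>x. x \<in> carrier X \<Longrightarrow> f x \<in> carrier Y"
    and "\<And>x y. \<lbrakk>x \<in> carrier X; y \<in> carrier X\<rbrakk> \<Longrightarrow> f (x \<squnion>\<^bsub>X\<^esub> y) = f x \<squnion>\<^bsub>Y\<^esub> f y"
  shows "join_hom X Y f"
  using assms by (auto simp: join_hom_def join_pres_def)

lemma join_homD:
  assumes "join_hom X Y f"
  shows "lattice X" "lattice Y" "x \<in> carrier X \<Longrightarrow> f x \<in> carrier Y"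
    and "\<lbrakk>x \<in> carrier X; y \<in> carrier X\<rbrakk> \<Longrightarrow> f (x \<squnion>\<^bsub>X\<^esub> y) = f x \<squnion>\<^bsub>Y\<^esub> f y"
  using assms by (auto simp: join_hom_def join_pres_def)

text \<open>The order is determined by joins: \<open>x\<close> is below \<open>y\<close> exactly if
  their join is \<open>y\<close>. Hence preserving joins is enough for monotonicity.\<close>

lemma join_hom_mono:
  assumes "join_hom X Y f" "x \<in> carrier X" "y \<in> carrier X" "x \<sqsubseteq>\<^bsub>X\<^esub> y"
  shows "f x \<sqsubseteq>\<^bsub>Y\<^esub> f y"
proof -
  note f = join_homD[OF assms(1)]
  have "f x \<squnion>\<^bsub>Y\<^esub> f y = f y"
    using f(4)[OF assms(2,3)] join_absorb(1)[OF f(1) assms(2-4)] by simp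
  then show ?thesis
    using lattice_join(2)[OF f(2) f(3)[OF assms(2)] f(3)[OF assms(3)]] by simp
qed

lemma lattice_hom_comp:
  assumes "lattice_hom X Y f" "lattice_hom Y Z g"
  shows "lattice_hom X Z (\<lambda>x. g (f x))"
  by (rule lattice_homI) (auto simp: lattice_homD[OF assms(1)] lattice_homD[OF assms(2)])

lemma lattice_hom_const:
  assumes "lattice X" "lattice Y" "c \<in> carrier Y"
  shows "lattice_hom X Y (\<lambda>x. c)"
  by (rule lattice_homI) (use assms in \<open>auto simp: join_idem meet_idem\<close>)

lemma lattice_hom_sublattice:
  assumes X: "lattice X" and S: "lattice_closed X S"
  shows "lattice_hom (X\<lparr>carrier := S\<rparr>) X (\<lambda>x. x)"
    and "\<lbrakk>lattice_hom Y X f; \<And>y. y \<in> carrier Y \<Longrightarrow> f y \<in> S\<rbrakk> \<Longrightarrow> lattice_hom Y (X\<lparr>carrier := S\<rparr>) f"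
proof -
  note sub = sublattice[OF X S]
  show "lattice_hom (X\<lparr>carrier := S\<rparr>) X (\<lambda>x. x)"
    by (rule lattice_homI) (use S in \<open>auto simp: sub X lattice_closed_def\<close>)
  show "lattice_hom Y (X\<lparr>carrier := S\<rparr>) f" if "lattice_hom Y X f" "\<And>y. y \<in> carrier Y \<Longrightarrow> f y \<in> S"
    by (rule lattice_homI) (use that(2) in \<open>auto simp: sub lattice_homD[OF that(1)]\<close>)
qed

section \<open>Transport of structure into the universe\<close>

text \<open>Classes such as \<open>V\<close> only contain lattices on the universe type. A lattice
  on another type is represented there by its copy along an injection \<open>e\<close>, whose
  inverse pulls the order back.\<close>

definition image_order :: "'a gorder \<Rightarrow> ('a \<Rightarrow> 'b) \<Rightarrow> 'b gorder" where
  "image_order X e =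
     \<lparr> carrier = e ` carrier X,
       eq = (=),
       le = (\<lambda>u v. inv_into (carrier X) e u \<sqsubseteq>\<^bsub>X\<^esub> inv_into (carrier X) e v) \<rparr>"

lemma carrier_image_order [simp]: "carrier (image_order X e) = e ` carrier X"
  by (simp add: image_order_def)

lemma image_order_iso:
  assumes X: "lattice X" and inj: "inj_on e (carrier X)"
  shows "lattice_hom X (image_order X e) e"
    and "lattice_hom (image_order X e) X (inv_into (carrier X) e)"
proof -
  let ?Y = "image_order X e" and ?i = "inv_into (carrier X) e"
  have le: "e x \<sqsubseteq>\<^bsub>?Y\<^esub> e y \<longleftrightarrow> x \<sqsubseteq>\<^bsub>X\<^esub> y" if "x \<in> carrier X" "y \<in> carrier X" for x y
    using that inj by (simp add: image_order_def)
  have eq: "eq ?Y = (=)" by (simp add: image_order_def)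
  note facts = lattice_le(1)[OF X] lattice_join[OF X] lattice_meet[OF X]
  have antisym: "u = v" if "u \<in> carrier ?Y" "v \<in> carrier ?Y" "u \<sqsubseteq>\<^bsub>?Y\<^esub> v" "v \<sqsubseteq>\<^bsub>?Y\<^esub> u" for u v
    using that by (auto simp: le dest: lattice_le(2)[OF X])
  have trans: "u \<sqsubseteq>\<^bsub>?Y\<^esub> w"
    if "u \<in> carrier ?Y" "v \<in> carrier ?Y" "w \<in> carrier ?Y" "u \<sqsubseteq>\<^bsub>?Y\<^esub> v" "v \<sqsubseteq>\<^bsub>?Y\<^esub> w" for u v w
    using that by (auto simp: le dest: lattice_le(3)[OF X])
  note ops = lattice_by_operations[where X = ?Y and j = "\<lambda>u v. e (?i u \<squnion>\<^bsub>X\<^esub> ?i v)"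
      and m = "\<lambda>u v. e (?i u \<sqinter>\<^bsub>X\<^esub> ?i v)", OF eq]
  have Y: "lattice ?Y"
    by (rule ops(1)) ((rule antisym trans; assumption) | clarsimp simp: le inj facts)+
  have J: "u \<squnion>\<^bsub>?Y\<^esub> v = e (?i u \<squnion>\<^bsub>X\<^esub> ?i v)" if "u \<in> carrier ?Y" "v \<in> carrier ?Y" for u v
    by (rule ops(2)) ((rule antisym trans; assumption) | use that in \<open>clarsimp simp: le inj facts\<close>)+
  have M: "u \<sqinter>\<^bsub>?Y\<^esub> v = e (?i u \<sqinter>\<^bsub>X\<^esub> ?i v)" if "u \<in> carrier ?Y" "v \<in> carrier ?Y" for u v
    by (rule ops(3)) ((rule antisym trans; assumption) | use that in \<open>clarsimp simp: le inj facts\<close>)+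
  show "lattice_hom X ?Y e"
    by (rule lattice_homI) (auto simp: X Y J M inj)
  show "lattice_hom ?Y X ?i"
    by (rule lattice_homI) (auto simp: X Y J M inj facts)
qed

text \<open>
  The image of \<open>\<epsilon>\<close> is no larger than \<open>X\<close>, so it too has a copy in the universe; the copy lies in
  \<open>V\<close> although the product need not fit there.
\<close>

lemma class_comp_image_order:
  fixes V :: "'u gorder set" and X :: "'a gorder" and F :: "'j \<Rightarrow> 'u gorder" and e :: "'a \<Rightarrow> 'u"
  assumes V: "prevariety V" and X: "nonempty_lattice X" and F: "\<And>j. j \<in> J \<Longrightarrow> F j \<in> V"
    and \<epsilon>: "lattice_hom X (direct_product J F) \<epsilon>"
    and dist: "\<And>x y z. \<lbrakk>x \<in> carrier X; y \<in> carrier X; z \<in> carrier X; \<epsilon> x = \<epsilon> y; \<epsilon> x = \<epsilon> z\<rbrakk> \<Longrightarrow>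
       x \<sqinter>\<^bsub>X\<^esub> (y \<squnion>\<^bsub>X\<^esub> z) = (x \<sqinter>\<^bsub>X\<^esub> y) \<squnion>\<^bsub>X\<^esub> (x \<sqinter>\<^bsub>X\<^esub> z)"
    and inj: "inj_on e (carrier X)"
  shows "image_order X e \<in> class_comp distributive_lattices V"
proof -
  let ?P = "direct_product J F" and ?Y = "image_order X e" and ?i = "inv_into (carrier X) e"
  have XL: "lattice X" "carrier X \<noteq> {}" using X by (auto simp: nonempty_lattice_def)
  note \<epsilon>D = lattice_homD[OF \<epsilon>]
  \<comment> \<open>The image of a homomorphism is a sublattice of the product.\<close>
  define B where "B = \<epsilon> ` carrier X"
  have BP: "B \<subseteq> carrier ?P" using \<epsilon>D(3) by (auto simp: B_def)
  have Bj: "u \<squnion>\<^bsub>?P\<^esub> v \<in> B" and Bm: "u \<sqinter>\<^bsub>?P\<^esub> v \<in> B" if uv: "u \<in> B" "v \<in> B" for u v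
  proof -
    obtain x y where "x \<in> carrier X" "y \<in> carrier X" "u = \<epsilon> x" "v = \<epsilon> y"
      using uv by (auto simp: B_def)
    then show "u \<squnion>\<^bsub>?P\<^esub> v \<in> B" "u \<sqinter>\<^bsub>?P\<^esub> v \<in> B"
      using \<epsilon>D(4,5)[of x y] lattice_join(1)[OF XL(1), of x y] lattice_meet(1)[OF XL(1), of x y]
      by (metis B_def image_eqI)+
  qed
  have B: "lattice_closed ?P B" using BP Bj Bm by (simp add: lattice_closed_def)
  let ?B = "?P\<lparr>carrier := B\<rparr>"
  note subB = lattice_hom_sublattice[OF \<epsilon>D(2) B]
  \<comment> \<open>Each element of the image is coded by the code of one chosen preimage in
    \<open>X\<close>. This puts a copy of \<open>B\<close> on the universe type although the product
    itself lives on a function type.\<close>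
  define k where "k b = e (inv_into (carrier X) \<epsilon> b)" for b
  have k: "inj_on k (carrier ?B)"
  proof (rule inj_onI)
    fix a b assume ab: "a \<in> carrier ?B" "b \<in> carrier ?B" "k a = k b"
    have "inv_into (carrier X) \<epsilon> a = inv_into (carrier X) \<epsilon> b"
      by (rule inj_onD[OF inj]) (use ab in \<open>simp_all add: k_def B_def inv_into_into\<close>)
    then show "a = b" using ab(1,2) by (simp add: B_def inv_into_injective)
  qed
  let ?N = "image_order ?B k"
  note isoB = image_order_iso[OF lattice_homD(1)[OF subB(1)] k]
  note isoX = image_order_iso[OF XL(1) inj]
  \<comment> \<open>\<open>?N\<close> is isomorphic to a sublattice of a product of members of
    \<open>V\<close>; \<open>prevariety_closed\<close> permits an arbitrary index type for that
    product.\<close>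
  have "?N \<in> V"
  proof (rule prevariety_closed[OF V _ F])
    show "nonempty_lattice ?N"
      using lattice_homD(2)[OF isoB(1)] XL(2) by (auto simp: nonempty_lattice_def B_def)
    show "lattice_hom ?N ?P (inv_into (carrier ?B) k)"
      by (rule lattice_hom_comp[OF isoB(2) subB(1)])
    show "inj_on (inv_into (carrier ?B) k) (carrier ?N)"
      by (simp add: inj_on_inv_into)
  qed
  define \<delta> where "\<delta> u = k (\<epsilon> (?i u))" for u
  have \<delta>: "lattice_hom ?Y ?N \<delta>"
    unfolding \<delta>_def
    by (rule lattice_hom_comp[OF lattice_hom_comp[OF isoX(2)] isoB(1)])
      (rule subB(2)[OF \<epsilon>], simp add: B_def)
  note \<delta>D = lattice_homD[OF \<delta>]
  have Y: "nonempty_lattice ?Y"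
    using lattice_homD(2)[OF isoX(1)] XL(2) by (simp add: nonempty_lattice_def)
  have fiber: "?Y\<lparr>carrier := {u \<in> carrier ?Y. \<delta> u = b}\<rparr> \<in> distributive_lattices"
    if b: "b \<in> carrier ?N" and ne: "{u \<in> carrier ?Y. \<delta> u = b} \<noteq> {}" for b
  proof -
    define S where "S = {u \<in> carrier ?Y. \<delta> u = b}"
    have Sj: "u \<squnion>\<^bsub>?Y\<^esub> v \<in> S" if "u \<in> S" "v \<in> S" for u v
      using that b \<delta>D(4)[of u v] lattice_join(1)[OF \<delta>D(1), of u v] join_idem[OF \<delta>D(2) b]
      by (auto simp: S_def)
    have Sm: "u \<sqinter>\<^bsub>?Y\<^esub> v \<in> S" if "u \<in> S" "v \<in> S" for u v
      using that b \<delta>D(5)[of u v] lattice_meet(1)[OF \<delta>D(1), of u v] meet_idem[OF \<delta>D(2) b]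
      by (auto simp: S_def)
    have S: "lattice_closed ?Y S" using Sj Sm by (auto simp: lattice_closed_def S_def)
    note sub = sublattice[OF \<delta>D(1) S]
    have "u \<sqinter>\<^bsub>?Y\<^esub> (v \<squnion>\<^bsub>?Y\<^esub> w) = (u \<sqinter>\<^bsub>?Y\<^esub> v) \<squnion>\<^bsub>?Y\<^esub> (u \<sqinter>\<^bsub>?Y\<^esub> w)"
      if uvw: "u \<in> S" "v \<in> S" "w \<in> S" for u v w
    proof -
      obtain x y z where xyz: "x \<in> carrier X" "y \<in> carrier X" "z \<in> carrier X"
        and e: "u = e x" "v = e y" "w = e z"
        using uvw by (auto simp: S_def)
      \<comment> \<open>Since \<open>k\<close> is injective on \<open>B\<close>, a fiber of
        \<open>\<delta>\<close> corresponds to a fiber of \<open>\<epsilon>\<close>, where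
        distributivity is assumed.\<close>
      have "k (\<epsilon> x) = k (\<epsilon> y)" "k (\<epsilon> x) = k (\<epsilon> z)"
        using uvw xyz inj by (auto simp: S_def \<delta>_def e)
      then have "\<epsilon> x = \<epsilon> y" "\<epsilon> x = \<epsilon> z"
        using inj_on_eq_iff[OF k] xyz by (simp_all add: B_def)
      from dist[OF xyz this]
      show ?thesis
        using xyz by (simp add: e lattice_homD(4,5)[OF isoX(1), symmetric]
            lattice_join(1)[OF XL(1)] lattice_meet(1)[OF XL(1)])
    qed
    then show ?thesis
      using ne unfolding S_def[symmetric]
      by (simp add: distributive_lattices_def nonempty_lattice_def sub Sj Sm del: carrier_image_order)
  qed
  show ?thesis
    unfolding class_comp_def using Y \<open>?N \<in> V\<close> \<delta> fiber by blast
qed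

section \<open>Lattice terms and the size of generated sublattices\<close>

datatype 'a lterm = Var 'a | Join "'a lterm" "'a lterm" | Meet "'a lterm" "'a lterm"

text \<open>An infinite set is equinumerous with its square, so terms can be coded recursively by
  pairing. Three distinct tags, taken from a copy of the natural numbers in \<open>'u\<close>, tell
  the constructors apart.\<close>

lemma lterm_encoding:
  assumes "infinite (UNIV :: 'u set)"
  obtains f :: "'u lterm \<Rightarrow> 'u" where "inj f"
proof -
  obtain p :: "'u \<times> 'u \<Rightarrow> 'u" where "bij p"
    using card_of_Times_same_infinite[OF assms] card_of_ordIso by auto
  then have p: "p x = p y \<longleftrightarrow> x = y" for x y by (auto dest: bij_is_inj injD)
  obtain c :: "nat \<Rightarrow> 'u" where "inj c"
    using assms by (auto simp: infinite_iff_countable_subset)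
  then have c: "c m = c n \<longleftrightarrow> m = n" for m n by (auto dest: injD)
  define f where "f = rec_lterm (\<lambda>u. p (c 0, u)) (\<lambda>s t a b. p (c 1, p (a, b)))
    (\<lambda>s t a b. p (c 2, p (a, b)))"
  have f: "f (Var u) = p (c 0, u)" "f (Join s t) = p (c 1, p (f s, f t))"
    "f (Meet s t) = p (c 2, p (f s, f t))" for u s t
    by (simp_all add: f_def)
  have "f s = f t \<longrightarrow> s = t" for s t
  proof (induction s arbitrary: t)
    case (Var u) then show ?case by (cases t) (auto simp: f p c)
  next
    case (Join s1 s2) then show ?case by (cases t) (auto simp: f p c)
  next
    case (Meet s1 s2) then show ?case by (cases t) (auto simp: f p c)
  qed
  then have "inj f" by (auto intro: injI)
  then show thesis by (rule that)
qed

text \<open>The values of all lattice terms under the assignment \<open>g\<close> form a sublattice.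
  Choosing a term for each value and coding that term bounds its size by that of the universe,
  however large the type \<open>'a\<close> is.\<close>

lemma generated_sublattice:
  fixes X :: "'a gorder" and g :: "'u \<Rightarrow> 'a"
  assumes inf: "infinite (UNIV :: 'u set)" and X: "lattice X" and g: "\<And>u. g u \<in> carrier X"
  obtains S and e :: "'a \<Rightarrow> 'u" where "lattice_closed X S" "range g \<subseteq> S" "inj_on e S"
proof -
  obtain f :: "'u lterm \<Rightarrow> 'u" where f: "inj f" by (rule lterm_encoding[OF inf])
  define v where "v = rec_lterm g (\<lambda>s t. join X) (\<lambda>s t. meet X)"
  have v: "v (Var u) = g u" "v (Join s t) = v s \<squnion>\<^bsub>X\<^esub> v t" "v (Meet s t) = v s \<sqinter>\<^bsub>X\<^esub> v t" for u s t
    by (simp_all add: v_def)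
  have vX: "v t \<in> carrier X" for t
    by (induction t) (simp_all add: v g lattice_join(1)[OF X] lattice_meet(1)[OF X])
  show thesis
  proof (rule that[of "range v" "f \<circ> inv v"])
    have "x \<squnion>\<^bsub>X\<^esub> y \<in> range v" "x \<sqinter>\<^bsub>X\<^esub> y \<in> range v" if "x \<in> range v" "y \<in> range v" for x y
      using that by (auto simp flip: v)
    then show "lattice_closed X (range v)" using vX by (auto simp: lattice_closed_def)
    show "range g \<subseteq> range v" using v(1) by (metis image_subsetI rangeI)
    show "inj_on (f \<circ> inv v) (range v)"
      by (intro comp_inj_on inj_on_inv_into inj_on_subset[OF f]) auto
  qed
qed

section \<open>Downsets of formal meets\<close>

text \<open>Neither \<open>V\<close> nor the free product occurs here: the test lattice and its map
  to \<open>M\<close> are built from the given lattices and maps alone.\<close>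

locale join_hom_family =
  fixes I :: "'i set" and Ls :: "'i \<Rightarrow> 'a gorder" and M :: "'m gorder" and \<phi>s :: "'i \<Rightarrow> 'a \<Rightarrow> 'm"
  assumes Ls_nonempty: "i \<in> I \<Longrightarrow> nonempty_lattice (Ls i)"
    and M: "lattice M"
    and \<phi>s: "i \<in> I \<Longrightarrow> join_hom (Ls i) M (\<phi>s i)"
begin

lemma Ls: "lattice (Ls i)" if "i \<in> I"
  using Ls_nonempty[OF that] by (simp add: nonempty_lattice_def)

text \<open>A partial map \<open>q\<close> stands for the formal meet of the elements \<open>q i\<close>, \<open>i \<in> dom q\<close>.\<close>

definition formal_meets :: "('i \<rightharpoonup> 'a) set" where
  "formal_meets =
     {q. finite (dom q) \<and> dom q \<noteq> {} \<and> (\<forall>i x. q i = Some x \<longrightarrow> i \<in> I \<and> x \<in> carrier (Ls i))}"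

text \<open>A meet gets smaller when factors are added, so the larger formal meet has the smaller
  domain.\<close>

definition fm_le :: "('i \<rightharpoonup> 'a) \<Rightarrow> ('i \<rightharpoonup> 'a) \<Rightarrow> bool" where
  "fm_le q r \<longleftrightarrow> (\<forall>i y. r i = Some y \<longrightarrow> (\<exists>x. q i = Some x \<and> x \<sqsubseteq>\<^bsub>Ls i\<^esub> y))"

definition fm_meet :: "('i \<rightharpoonup> 'a) \<Rightarrow> ('i \<rightharpoonup> 'a) \<Rightarrow> 'i \<rightharpoonup> 'a" where
  "fm_meet q r = (\<lambda>i. case q i of None \<Rightarrow> r i | Some x \<Rightarrow>
     (case r i of None \<Rightarrow> Some x | Some y \<Rightarrow> Some (x \<sqinter>\<^bsub>Ls i\<^esub> y)))"

lemma formal_meetsD: "\<lbrakk>q \<in> formal_meets; q i = Some x\<rbrakk> \<Longrightarrow> i \<in> I \<and> x \<in> carrier (Ls i)"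
  by (simp add: formal_meets_def)

lemma single_formal_meets [simp]: "[i \<mapsto> x] \<in> formal_meets \<longleftrightarrow> i \<in> I \<and> x \<in> carrier (Ls i)"
  by (auto simp: formal_meets_def)

lemma fm_le_refl: "q \<in> formal_meets \<Longrightarrow> fm_le q q"
  using formal_meetsD lattice_le(1)[OF Ls] by (fastforce simp: fm_le_def)

lemma fm_le_trans:
  assumes "q \<in> formal_meets" "r \<in> formal_meets" "s \<in> formal_meets" "fm_le q r" "fm_le r s"
  shows "fm_le q s"
  unfolding fm_le_def
proof (intro allI impI)
  fix i z assume z: "s i = Some z"
  then obtain y where y: "r i = Some y" "y \<sqsubseteq>\<^bsub>Ls i\<^esub> z" using assms(5) by (auto simp: fm_le_def)
  then obtain x where x: "q i = Some x" "x \<sqsubseteq>\<^bsub>Ls i\<^esub> y" using assms(4) by (auto simp: fm_le_def)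
  have "i \<in> I" using formal_meetsD[OF assms(3) z] by simp
  from lattice_le(3)[OF Ls[OF this], of x y z] show "\<exists>x. q i = Some x \<and> x \<sqsubseteq>\<^bsub>Ls i\<^esub> z"
    using x y formal_meetsD[OF assms(1) x(1)] formal_meetsD[OF assms(2) y(1)]
      formal_meetsD[OF assms(3) z] by auto
qed

lemma fm_le_single: "fm_le q [i \<mapsto> y] \<longleftrightarrow> (\<exists>x. q i = Some x \<and> x \<sqsubseteq>\<^bsub>Ls i\<^esub> y)"
  by (auto simp: fm_le_def)

text \<open>Domains shrink upwards but stay nonempty, so only single elements of \<open>Ls i\<close>
  lie above a single element of \<open>Ls i\<close>.\<close>

lemma single_fm_le:
  assumes "r \<in> formal_meets" "fm_le [i \<mapsto> x] r"
  obtains y where "r = [i \<mapsto> y]" "x \<sqsubseteq>\<^bsub>Ls i\<^esub> y"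
proof -
  have "j = i" if "r j = Some y" for j y
    using assms(2) that by (auto simp: fm_le_def split: if_splits)
  then have "dom r \<subseteq> {i}" by auto
  moreover have "dom r \<noteq> {}" using assms(1) by (simp add: formal_meets_def)
  ultimately have "dom r = {i}" by blast
  then obtain y where "r = [i \<mapsto> y]" by (auto simp: dom_eq_singleton_conv)
  moreover have "x \<sqsubseteq>\<^bsub>Ls i\<^esub> y" using assms(2) \<open>r = [i \<mapsto> y]\<close> by (simp add: fm_le_single)
  ultimately show thesis by (rule that)
qed

lemma fm_meet:
  assumes q: "q \<in> formal_meets" and r: "r \<in> formal_meets"
  shows "fm_meet q r \<in> formal_meets" "fm_le (fm_meet q r) q" "fm_le (fm_meet q r) r"
    and "\<lbrakk>s \<in> formal_meets; fm_le s q; fm_le s r\<rbrakk> \<Longrightarrow> fm_le s (fm_meet q r)"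
proof -
  note Dq = formal_meetsD[OF q] and Dr = formal_meetsD[OF r]
  have dom: "dom (fm_meet q r) = dom q \<union> dom r"
    by (auto simp: fm_meet_def split: option.splits)
  have "i \<in> I \<and> x \<in> carrier (Ls i)" if "fm_meet q r i = Some x" for i x
    using that Dq[of i] Dr[of i] lattice_meet(1)[OF Ls]
    by (auto simp: fm_meet_def split: option.splits)
  then show "fm_meet q r \<in> formal_meets"
    using q r unfolding formal_meets_def dom mem_Collect_eq by blast
  show "fm_le (fm_meet q r) q" "fm_le (fm_meet q r) r"
    using Dq Dr lattice_le(1)[OF Ls] lattice_meet(2,3)[OF Ls]
    by (auto simp: fm_le_def fm_meet_def split: option.splits)
  show "fm_le s (fm_meet q r)" if s: "s \<in> formal_meets" "fm_le s q" "fm_le s r"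
    unfolding fm_le_def
  proof (intro allI impI)
    fix i z assume z: "fm_meet q r i = Some z"
    show "\<exists>x. s i = Some x \<and> x \<sqsubseteq>\<^bsub>Ls i\<^esub> z"
    proof (cases "q i")
      case None
      then show ?thesis using z s(3) by (simp add: fm_meet_def fm_le_def)
    next
      case q: (Some x)
      show ?thesis
      proof (cases "r i")
        case None
        then show ?thesis using q z s(2) by (simp add: fm_meet_def fm_le_def)
      next
        case r: (Some y)
        obtain w where "s i = Some w" "w \<sqsubseteq>\<^bsub>Ls i\<^esub> x" "w \<sqsubseteq>\<^bsub>Ls i\<^esub> y"
          using s(2,3) q r unfolding fm_le_def by fastforce
        moreover have "z = x \<sqinter>\<^bsub>Ls i\<^esub> y" using z q r by (simp add: fm_meet_def)
        ultimately show ?thesis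
          using lattice_meet(4)[OF Ls, of i x y w] Dq[OF q] Dr[OF r] formal_meetsD[OF s(1)] by auto
      qed
    qed
  qed
qed

section \<open>Finitely generated downsets and their joins\<close>

definition down :: "('i \<rightharpoonup> 'a) set \<Rightarrow> ('i \<rightharpoonup> 'a) set" where
  "down G = {q \<in> formal_meets. \<exists>r\<in>G. fm_le q r}"

text \<open>Finite and nonempty generating sets, like the finite and nonempty domains of formal
  meets, guarantee that the suprema and infima taken later exist in \<open>M\<close>, which may be
  neither complete nor bounded.\<close>

definition fg_downsets :: "('i \<rightharpoonup> 'a) set set" where
  "fg_downsets = {down G |G. finite G \<and> G \<noteq> {} \<and> G \<subseteq> formal_meets}"

lemma fg_downsetsI: "\<lbrakk>finite G; G \<noteq> {}; G \<subseteq> formal_meets\<rbrakk> \<Longrightarrow> down G \<in> fg_downsets"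
  by (auto simp: fg_downsets_def)

lemma fg_downsetsE:
  assumes "D \<in> fg_downsets"
  obtains G where "finite G" "G \<noteq> {}" "G \<subseteq> formal_meets" "D = down G"
  using assms by (auto simp: fg_downsets_def)

lemma fg_downset_subset: "D \<in> fg_downsets \<Longrightarrow> q \<in> D \<Longrightarrow> q \<in> formal_meets"
  by (auto simp: fg_downsets_def down_def)

lemma single_in_fg_downset:
  "\<lbrakk>D \<in> fg_downsets; [i \<mapsto> x] \<in> D\<rbrakk> \<Longrightarrow> i \<in> I \<and> x \<in> carrier (Ls i)"
  using fg_downset_subset by fastforce

lemma fg_downset_closed:
  assumes "D \<in> fg_downsets" "r \<in> D" "q \<in> formal_meets" "fm_le q r"
  shows "q \<in> D"
proof -
  obtain G where G: "G \<subseteq> formal_meets" "D = down G" using assms(1) by (rule fg_downsetsE)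
  then obtain g where g: "g \<in> G" "r \<in> formal_meets" "fm_le r g"
    using assms(2) by (auto simp: down_def)
  then have "fm_le q g" using fm_le_trans[OF assms(3) _ _ assms(4)] G(1) by blast
  then show ?thesis using assms(3) g(1) by (auto simp: G(2) down_def)
qed

lemma generator_in_down: "\<lbrakk>G \<subseteq> formal_meets; r \<in> G\<rbrakk> \<Longrightarrow> r \<in> down G"
  by (auto simp: down_def intro!: fm_le_refl)

text \<open>The downsets of \<open>g\<close> and \<open>h\<close> intersect in the downset of
  \<open>fm_meet g h\<close>, so the pairwise meets of generators generate the intersection.\<close>

lemma fg_downset_Int:
  assumes "D \<in> fg_downsets" "E \<in> fg_downsets"
  shows "D \<inter> E \<in> fg_downsets"
proof -
  obtain G where G: "finite G" "G \<noteq> {}" "G \<subseteq> formal_meets" "D = down G"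
    using assms(1) by (rule fg_downsetsE)
  obtain H where H: "finite H" "H \<noteq> {}" "H \<subseteq> formal_meets" "E = down H"
    using assms(2) by (rule fg_downsetsE)
  let ?GH = "(\<lambda>(q, r). fm_meet q r) ` (G \<times> H)"
  have GH: "?GH \<subseteq> formal_meets" using G(3) H(3) fm_meet(1) by auto
  have "q \<in> D \<inter> E \<longleftrightarrow> q \<in> down ?GH" for q
  proof
    assume "q \<in> D \<inter> E"
    then obtain g h where "q \<in> formal_meets" "g \<in> G" "h \<in> H" "fm_le q g" "fm_le q h"
      by (auto simp: G(4) H(4) down_def)
    then show "q \<in> down ?GH"
      using fm_meet(4)[of g h q] G(3) H(3) by (force simp: down_def)
  next
    assume "q \<in> down ?GH"
    then obtain g h where q: "q \<in> formal_meets" and gh: "g \<in> G" "h \<in> H" and le: "fm_le q (fm_meet g h)"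
      by (auto simp: down_def)
    have "g \<in> formal_meets" "h \<in> formal_meets" using gh G(3) H(3) by auto
    note m = fm_meet[OF this]
    have "fm_le q g" "fm_le q h"
      using fm_le_trans[OF q m(1) _ le] m(2,3) \<open>g \<in> formal_meets\<close> \<open>h \<in> formal_meets\<close> by auto
    then show "q \<in> D \<inter> E" using q gh by (auto simp: G(4) H(4) down_def)
  qed
  then have "D \<inter> E = down ?GH" by blast
  then show ?thesis using fg_downsetsI[of ?GH] G(1,2) H(1,2) GH by simp
qed

text \<open>
  Elements of one and the same \<open>L\<^sub>i\<close> have to be joined inside \<open>L\<^sub>i\<close>; no other joins are identified.
\<close>

definition down_join :: "('i \<rightharpoonup> 'a) set \<Rightarrow> ('i \<rightharpoonup> 'a) set \<Rightarrow> ('i \<rightharpoonup> 'a) set" where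
  "down_join D E = D \<union> E \<union>
     {q \<in> formal_meets. \<exists>i x y. [i \<mapsto> x] \<in> D \<and> [i \<mapsto> y] \<in> E \<and> fm_le q [i \<mapsto> x \<squnion>\<^bsub>Ls i\<^esub> y]}"

text \<open>It suffices to add to both generating sets the joins of single generators from the same
  \<open>Ls i\<close>: by \<open>single_fm_le\<close> a single element of a downset lies below a
  single generator, and joins are monotone.\<close>

lemma fg_downset_join:
  assumes D: "D \<in> fg_downsets" and E: "E \<in> fg_downsets"
  shows "down_join D E \<in> fg_downsets"
proof -
  obtain G where G: "finite G" "G \<noteq> {}" "G \<subseteq> formal_meets" "D = down G"
    using assms(1) by (rule fg_downsetsE)
  obtain H where H: "finite H" "H \<noteq> {}" "H \<subseteq> formal_meets" "E = down H"
    using assms(2) by (rule fg_downsetsE)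
  define K where "K = {[i \<mapsto> x \<squnion>\<^bsub>Ls i\<^esub> y] |i x y. [i \<mapsto> x] \<in> G \<and> [i \<mapsto> y] \<in> H}"
  \<comment> \<open>The index of a single generator is recovered as the only element of its domain;
    thus \<open>K\<close> is covered by an image of the finite set
    \<open>G \<times> H\<close>.\<close>
  have "K \<subseteq> (\<lambda>(g, h). let i = (SOME i. i \<in> dom g) in [i \<mapsto> the (g i) \<squnion>\<^bsub>Ls i\<^esub> the (h i)]) ` (G \<times> H)"
    by (force simp: K_def image_iff)
  then have K: "finite K" using G(1) H(1) by (auto intro: finite_subset)
  have KQ: "K \<subseteq> formal_meets"
  proof
    fix k assume "k \<in> K"
    then obtain i x y where k: "k = [i \<mapsto> x \<squnion>\<^bsub>Ls i\<^esub> y]" "[i \<mapsto> x] \<in> G" "[i \<mapsto> y] \<in> H"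
      by (auto simp: K_def)
    then have "[i \<mapsto> x] \<in> formal_meets" "[i \<mapsto> y] \<in> formal_meets" using G(3) H(3) by auto
    then show "k \<in> formal_meets" using lattice_join(1)[OF Ls] by (simp add: k(1))
  qed
  have "q \<in> down_join D E \<longleftrightarrow> q \<in> down (G \<union> H \<union> K)" for q
  proof
    assume q: "q \<in> down_join D E"
    show "q \<in> down (G \<union> H \<union> K)"
    proof (cases "q \<in> D \<union> E")
      case True
      then show ?thesis by (auto simp: G(4) H(4) down_def)
    next
      case False
      then obtain i x y where Q: "q \<in> formal_meets" and xy: "[i \<mapsto> x] \<in> D" "[i \<mapsto> y] \<in> E"
        and le: "fm_le q [i \<mapsto> x \<squnion>\<^bsub>Ls i\<^esub> y]"
        using q by (auto simp: down_join_def)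
      obtain g h where gh: "g \<in> G" "h \<in> H" "fm_le [i \<mapsto> x] g" "fm_le [i \<mapsto> y] h"
        using xy by (auto simp: G(4) H(4) down_def)
      obtain x' where x': "g = [i \<mapsto> x']" "x \<sqsubseteq>\<^bsub>Ls i\<^esub> x'"
        using single_fm_le gh(1,3) G(3) by blast
      obtain y' where y': "h = [i \<mapsto> y']" "y \<sqsubseteq>\<^bsub>Ls i\<^esub> y'"
        using single_fm_le gh(2,4) H(3) by blast
      have i: "i \<in> I" and c: "x \<in> carrier (Ls i)" "y \<in> carrier (Ls i)"
        using single_in_fg_downset[OF D xy(1)] single_in_fg_downset[OF E xy(2)] by simp_all
      have c': "x' \<in> carrier (Ls i)" "y' \<in> carrier (Ls i)"
        using subsetD[OF G(3) gh(1)] subsetD[OF H(3) gh(2)] by (simp_all add: x'(1) y'(1))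
      note j = lattice_join[OF Ls[OF i]] and tr = lattice_le(3)[OF Ls[OF i]]
      have "x \<squnion>\<^bsub>Ls i\<^esub> y \<sqsubseteq>\<^bsub>Ls i\<^esub> x' \<squnion>\<^bsub>Ls i\<^esub> y'"
        using tr[OF c(1) c'(1) j(1)[OF c'] x'(2) j(2)[OF c']]
          tr[OF c(2) c'(2) j(1)[OF c'] y'(2) j(3)[OF c']]
        by (rule j(4)[OF c j(1)[OF c']])
      then have "fm_le q [i \<mapsto> x' \<squnion>\<^bsub>Ls i\<^esub> y']"
        by (intro fm_le_trans[OF Q _ _ le]) (auto simp: i j(1)[OF c] j(1)[OF c'] fm_le_single)
      moreover have "[i \<mapsto> x' \<squnion>\<^bsub>Ls i\<^esub> y'] \<in> K" using gh x'(1) y'(1) by (auto simp: K_def)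
      ultimately show ?thesis using Q by (auto simp: down_def)
    qed
  next
    assume "q \<in> down (G \<union> H \<union> K)"
    then obtain r where q: "q \<in> formal_meets" "r \<in> G \<union> H \<union> K" "fm_le q r"
      by (auto simp: down_def)
    show "q \<in> down_join D E"
    proof (cases "r \<in> K")
      case True
      then obtain i x y where r: "r = [i \<mapsto> x \<squnion>\<^bsub>Ls i\<^esub> y]" "[i \<mapsto> x] \<in> G" "[i \<mapsto> y] \<in> H"
        by (auto simp: K_def)
      have "[i \<mapsto> x] \<in> D" "[i \<mapsto> y] \<in> E"
        using generator_in_down G(3,4) H(3,4) r(2,3) by auto
      then show ?thesis using q r(1) by (auto simp: down_join_def)
    next
      case False
      then show ?thesis using q by (auto simp: down_join_def G(4) H(4) down_def)
    qed
  qed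
  then have "down_join D E = down (G \<union> H \<union> K)" by blast
  then show ?thesis using fg_downsetsI[of "G \<union> H \<union> K"] G H K KQ by simp
qed

lemma single_in_down_join:
  assumes "D \<in> fg_downsets" "E \<in> fg_downsets"
  shows "[i \<mapsto> z] \<in> down_join D E \<longleftrightarrow> [i \<mapsto> z] \<in> D \<or> [i \<mapsto> z] \<in> E \<or>
    (z \<in> carrier (Ls i) \<and> (\<exists>x y. [i \<mapsto> x] \<in> D \<and> [i \<mapsto> y] \<in> E \<and> z \<sqsubseteq>\<^bsub>Ls i\<^esub> x \<squnion>\<^bsub>Ls i\<^esub> y))"
  unfolding down_join_def fm_le_single
  using single_in_fg_downset[OF assms(1)] by (force simp: fun_upd_apply split: if_splits)

section \<open>Evaluation in \<open>M\<close>\<close>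

definition fm_eval :: "('i \<rightharpoonup> 'a) \<Rightarrow> 'm" where
  "fm_eval q = \<Sqinter>\<^bsub>M\<^esub> ((\<lambda>i. \<phi>s i (the (q i))) ` dom q)"

lemma fm_eval:
  assumes q: "q \<in> formal_meets"
  shows "fm_eval q \<in> carrier M"
    and "q i = Some x \<Longrightarrow> fm_eval q \<sqsubseteq>\<^bsub>M\<^esub> \<phi>s i x"
    and "\<lbrakk>z \<in> carrier M; \<And>i x. q i = Some x \<Longrightarrow> z \<sqsubseteq>\<^bsub>M\<^esub> \<phi>s i x\<rbrakk> \<Longrightarrow> z \<sqsubseteq>\<^bsub>M\<^esub> fm_eval q"
proof -
  interpret M: lattice M by (rule M)
  let ?A = "(\<lambda>i. \<phi>s i (the (q i))) ` dom q"
  have A: "finite ?A" "?A \<noteq> {}" using q by (auto simp: formal_meets_def)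
  have AM: "?A \<subseteq> carrier M"
    using formal_meetsD[OF q] join_homD(3)[OF \<phi>s] by auto
  have glb: "greatest M (fm_eval q) (Lower M ?A)"
    unfolding fm_eval_def by (rule M.finite_inf_greatest[OF A(1) AM A(2)])
  then show "fm_eval q \<in> carrier M" by (rule greatest_closed)
  show "fm_eval q \<sqsubseteq>\<^bsub>M\<^esub> \<phi>s i x" if "q i = Some x"
  proof (rule greatest_Lower_below[OF glb _ AM])
    show "\<phi>s i x \<in> ?A" by (rule image_eqI[of _ _ i]) (use that in auto)
  qed
  show "z \<sqsubseteq>\<^bsub>M\<^esub> fm_eval q" if "z \<in> carrier M" "\<And>i x. q i = Some x \<Longrightarrow> z \<sqsubseteq>\<^bsub>M\<^esub> \<phi>s i x"
  proof (rule greatest_le[OF glb], rule Lower_memI[OF _ that(1)])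
    fix a assume "a \<in> ?A"
    then obtain i x where "a = \<phi>s i x" "q i = Some x" by auto
    then show "z \<sqsubseteq>\<^bsub>M\<^esub> a" using that(2) by simp
  qed
qed

lemma fm_eval_mono:
  assumes q: "q \<in> formal_meets" and r: "r \<in> formal_meets" and le: "fm_le q r"
  shows "fm_eval q \<sqsubseteq>\<^bsub>M\<^esub> fm_eval r"
proof (rule fm_eval(3)[OF r fm_eval(1)[OF q]])
  fix i y assume y: "r i = Some y"
  then obtain x where x: "q i = Some x" "x \<sqsubseteq>\<^bsub>Ls i\<^esub> y" using le by (auto simp: fm_le_def)
  have i: "i \<in> I" "x \<in> carrier (Ls i)" "y \<in> carrier (Ls i)"
    using formal_meetsD[OF q x(1)] formal_meetsD[OF r y] by auto
  note \<phi> = \<phi>s[OF i(1)]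
  show "fm_eval q \<sqsubseteq>\<^bsub>M\<^esub> \<phi>s i y"
    by (rule lattice_le(3)[OF M fm_eval(1)[OF q] join_homD(3)[OF \<phi> i(2)] join_homD(3)[OF \<phi> i(3)]
          fm_eval(2)[OF q x(1)] join_hom_mono[OF \<phi> i(2,3) x(2)]])
qed

lemma fm_eval_single:
  assumes "i \<in> I" "x \<in> carrier (Ls i)"
  shows "fm_eval [i \<mapsto> x] = \<phi>s i x"
proof -
  have q: "[i \<mapsto> x] \<in> formal_meets" using assms by simp
  have c: "\<phi>s i x \<in> carrier M" by (rule join_homD(3)[OF \<phi>s[OF assms(1)] assms(2)])
  have "\<phi>s i x \<sqsubseteq>\<^bsub>M\<^esub> fm_eval [i \<mapsto> x]"
    by (rule fm_eval(3)[OF q c]) (use lattice_le(1)[OF M c] in \<open>simp split: if_splits\<close>)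
  then show ?thesis
    using lattice_le(2)[OF M fm_eval(1)[OF q] c fm_eval(2)[OF q]] by simp
qed

definition down_eval :: "('i \<rightharpoonup> 'a) set \<Rightarrow> 'm" where
  "down_eval D = \<Squnion>\<^bsub>M\<^esub> (fm_eval ` D)"

text \<open>The set \<open>D\<close> may be infinite, but by monotonicity of \<open>fm_eval\<close>
  its values have the same upper bounds as those of a finite generating set. Hence the supremum
  exists.\<close>

lemma down_eval:
  assumes D: "D \<in> fg_downsets"
  shows "down_eval D \<in> carrier M"
    and "q \<in> D \<Longrightarrow> fm_eval q \<sqsubseteq>\<^bsub>M\<^esub> down_eval D"
    and "\<lbrakk>z \<in> carrier M; \<And>q. q \<in> D \<Longrightarrow> fm_eval q \<sqsubseteq>\<^bsub>M\<^esub> z\<rbrakk> \<Longrightarrow> down_eval D \<sqsubseteq>\<^bsub>M\<^esub> z"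
proof -
  interpret M: lattice M by (rule M)
  obtain G where G: "finite G" "G \<noteq> {}" "G \<subseteq> formal_meets" "D = down G"
    using D by (rule fg_downsetsE)
  have DM: "fm_eval ` D \<subseteq> carrier M" using fm_eval(1) fg_downset_subset[OF D] by auto
  have GD: "G \<subseteq> D" using generator_in_down[OF G(3)] G(4) by auto
  have "Upper M (fm_eval ` G) \<subseteq> Upper M (fm_eval ` D)"
  proof
    fix z assume z: "z \<in> Upper M (fm_eval ` G)"
    have zM: "z \<in> carrier M" using z by (simp add: Upper_def)
    have "fm_eval q \<sqsubseteq>\<^bsub>M\<^esub> z" if q: "q \<in> D" for q
    proof -
      obtain g where g: "q \<in> formal_meets" "g \<in> G" "fm_le q g"
        using q by (auto simp: G(4) down_def)
      have gQ: "g \<in> formal_meets" using g(2) G(3) by auto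
      have "fm_eval g \<sqsubseteq>\<^bsub>M\<^esub> z" using z g(2) fm_eval(1)[OF gQ] by (auto simp: Upper_def)
      then show ?thesis
        by (rule lattice_le(3)[OF M fm_eval(1)[OF g(1)] fm_eval(1)[OF gQ] zM fm_eval_mono[OF g(1) gQ g(3)]])
    qed
    then show "z \<in> Upper M (fm_eval ` D)" using zM by (auto simp: Upper_def)
  qed
  then have "Upper M (fm_eval ` D) = Upper M (fm_eval ` G)"
    using Upper_antimono[of "fm_eval ` G" "fm_eval ` D" M] GD by blast
  \<comment> \<open>\<open>sup\<close> depends on a set only through its upper bounds.\<close>
  then have "down_eval D = \<Squnion>\<^bsub>M\<^esub> (fm_eval ` G)" "Upper M (fm_eval ` D) = Upper M (fm_eval ` G)"
    by (simp_all add: down_eval_def sup_def)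
  moreover have "least M (\<Squnion>\<^bsub>M\<^esub> (fm_eval ` G)) (Upper M (fm_eval ` G))"
    by (rule M.finite_sup_least) (use G(1,2) GD DM in auto)
  ultimately have lub: "least M (down_eval D) (Upper M (fm_eval ` D))" by simp
  then show "down_eval D \<in> carrier M" by (rule least_closed)
  show "fm_eval q \<sqsubseteq>\<^bsub>M\<^esub> down_eval D" if "q \<in> D"
    by (rule least_Upper_above[OF lub _ DM]) (use that in simp)
  show "down_eval D \<sqsubseteq>\<^bsub>M\<^esub> z" if "z \<in> carrier M" "\<And>q. q \<in> D \<Longrightarrow> fm_eval q \<sqsubseteq>\<^bsub>M\<^esub> z"
    by (rule least_le[OF lub], rule Upper_memI) (use that in auto)
qed

lemma down_eval_mono:
  assumes "D \<in> fg_downsets" "E \<in> fg_downsets" "D \<subseteq> E"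
  shows "down_eval D \<sqsubseteq>\<^bsub>M\<^esub> down_eval E"
  by (rule down_eval(3)[OF assms(1) down_eval(1)[OF assms(2)]])
    (use down_eval(2)[OF assms(2)] assms(3) in auto)

text \<open>Beyond \<open>D \<union> E\<close>, \<open>down_join\<close> only adds formal meets
  below a join of \<open>x\<close> and \<open>y\<close> in one \<open>Ls i\<close>, with
  \<open>x\<close> in \<open>D\<close> and \<open>y\<close> in \<open>E\<close>. Because
  \<open>\<phi>s i\<close> preserves this join, their values remain below the join of the two
  suprema.\<close>

lemma down_eval_join:
  assumes D: "D \<in> fg_downsets" and E: "E \<in> fg_downsets"
  shows "down_eval (down_join D E) = down_eval D \<squnion>\<^bsub>M\<^esub> down_eval E"
proof (rule lattice_le(2)[OF M])
  note DE = fg_downset_join[OF D E]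
  note d = down_eval(1)[OF D] and e = down_eval(1)[OF E] and de = down_eval(1)[OF DE]
  note j = lattice_join[OF M d e] and tr = lattice_le(3)[OF M]
  show "down_eval (down_join D E) \<in> carrier M" "down_eval D \<squnion>\<^bsub>M\<^esub> down_eval E \<in> carrier M"
    by (rule de, rule j(1))
  show "down_eval D \<squnion>\<^bsub>M\<^esub> down_eval E \<sqsubseteq>\<^bsub>M\<^esub> down_eval (down_join D E)"
    by (rule j(4)[OF de]; rule down_eval_mono[OF _ DE]) (auto simp: D E down_join_def)
  show "down_eval (down_join D E) \<sqsubseteq>\<^bsub>M\<^esub> down_eval D \<squnion>\<^bsub>M\<^esub> down_eval E"
  proof (rule down_eval(3)[OF DE j(1)])
    fix q assume q: "q \<in> down_join D E"
    then have Q: "q \<in> formal_meets" by (rule fg_downset_subset[OF DE])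
    consider "q \<in> D" | "q \<in> E" | i x y where "[i \<mapsto> x] \<in> D" "[i \<mapsto> y] \<in> E" "fm_le q [i \<mapsto> x \<squnion>\<^bsub>Ls i\<^esub> y]"
      using q by (auto simp: down_join_def)
    then show "fm_eval q \<sqsubseteq>\<^bsub>M\<^esub> down_eval D \<squnion>\<^bsub>M\<^esub> down_eval E"
    proof cases
      case 1
      show ?thesis by (rule tr[OF fm_eval(1)[OF Q] d j(1) down_eval(2)[OF D 1] j(2)])
    next
      case 2
      show ?thesis by (rule tr[OF fm_eval(1)[OF Q] e j(1) down_eval(2)[OF E 2] j(3)])
    next
      case 3
      have i: "i \<in> I" and x: "x \<in> carrier (Ls i)" and y: "y \<in> carrier (Ls i)"
        using single_in_fg_downset[OF D 3(1)] single_in_fg_downset[OF E 3(2)] by auto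
      note xy = lattice_join(1)[OF Ls[OF i] x y]
      note \<phi> = join_homD(3)[OF \<phi>s[OF i]]
      have "\<phi>s i x \<sqsubseteq>\<^bsub>M\<^esub> down_eval D" "\<phi>s i y \<sqsubseteq>\<^bsub>M\<^esub> down_eval E"
        using down_eval(2)[OF D 3(1)] down_eval(2)[OF E 3(2)] by (simp_all add: fm_eval_single i x y)
      then have "\<phi>s i x \<squnion>\<^bsub>M\<^esub> \<phi>s i y \<sqsubseteq>\<^bsub>M\<^esub> down_eval D \<squnion>\<^bsub>M\<^esub> down_eval E"
        using tr[OF \<phi>[OF x] d j(1) _ j(2)] tr[OF \<phi>[OF y] e j(1) _ j(3)]
        by (intro lattice_join(4)[OF M \<phi>[OF x] \<phi>[OF y] j(1)])
      moreover have "fm_eval q \<sqsubseteq>\<^bsub>M\<^esub> \<phi>s i x \<squnion>\<^bsub>M\<^esub> \<phi>s i y"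
        using fm_eval_mono[OF Q _ 3(3)] by (simp add: i xy fm_eval_single join_homD(4)[OF \<phi>s[OF i] x y])
      ultimately show ?thesis
        using tr[OF fm_eval(1)[OF Q] lattice_join(1)[OF M \<phi>[OF x] \<phi>[OF y]] j(1)] by blast
    qed
  qed
qed

section \<open>Compatibility of downsets with coordinate families\<close>

text \<open>
  \<open>f\<close> is the family of values, over all \<open>c\<close> in \<open>L\<^sub>i\<close>, of an element of the free product under the map
  that is the identity on \<open>L\<^sub>i\<close> and constant \<open>c\<close> on the other lattices; \<open>compatible\<close> says what the
  germ of \<open>f\<close> at \<open>-\<infinity>\<close> knows about the members of \<open>L\<^sub>i\<close> in \<open>D\<close>.
\<close>

definition compatible :: "'i \<Rightarrow> ('a \<Rightarrow> 'a) \<Rightarrow> ('i \<rightharpoonup> 'a) set \<Rightarrow> bool" where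
  "compatible i f D \<longleftrightarrow>
     (\<forall>x. [i \<mapsto> x] \<notin> D) \<and> (\<forall>c\<in>carrier (Ls i). f c \<sqsubseteq>\<^bsub>Ls i\<^esub> c) \<or>
     (\<exists>x\<in>carrier (Ls i). (\<forall>y\<in>carrier (Ls i). [i \<mapsto> y] \<in> D \<longleftrightarrow> y \<sqsubseteq>\<^bsub>Ls i\<^esub> x) \<and>
        (\<exists>c0\<in>carrier (Ls i). \<forall>c\<in>carrier (Ls i). c \<sqsubseteq>\<^bsub>Ls i\<^esub> c0 \<longrightarrow> f c = x))"

lemma compatible_cases:
  assumes "compatible i f D"
  obtains (none) "\<And>x. [i \<mapsto> x] \<notin> D" "\<And>c. c \<in> carrier (Ls i) \<Longrightarrow> f c \<sqsubseteq>\<^bsub>Ls i\<^esub> c"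
  | (principal) x c0 where "x \<in> carrier (Ls i)" "c0 \<in> carrier (Ls i)"
    "\<And>y. y \<in> carrier (Ls i) \<Longrightarrow> [i \<mapsto> y] \<in> D \<longleftrightarrow> y \<sqsubseteq>\<^bsub>Ls i\<^esub> x"
    "\<And>c. \<lbrakk>c \<in> carrier (Ls i); c \<sqsubseteq>\<^bsub>Ls i\<^esub> c0\<rbrakk> \<Longrightarrow> f c = x"
  using assms unfolding compatible_def by blast

lemma compatible_noneI:
  assumes "\<And>x. [i \<mapsto> x] \<notin> D" "\<And>c. c \<in> carrier (Ls i) \<Longrightarrow> f c \<sqsubseteq>\<^bsub>Ls i\<^esub> c"
  shows "compatible i f D"
  using assms by (simp add: compatible_def)

lemma compatible_principalI:
  assumes "x \<in> carrier (Ls i)" "c0 \<in> carrier (Ls i)"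
    "\<And>y. y \<in> carrier (Ls i) \<Longrightarrow> [i \<mapsto> y] \<in> D \<longleftrightarrow> y \<sqsubseteq>\<^bsub>Ls i\<^esub> x"
    "\<And>c. \<lbrakk>c \<in> carrier (Ls i); c \<sqsubseteq>\<^bsub>Ls i\<^esub> c0\<rbrakk> \<Longrightarrow> f c = x"
  shows "compatible i f D"
  unfolding compatible_def using assms by blast

text \<open>If one downset has no element of \<open>Ls i\<close>, neither has the intersection, and
  the meet of the families stays below \<open>c\<close>. If both are principal, both families are
  constant below \<open>c0 \<sqinter> c1\<close>, with the meet of the two bounds as the meet of
  their values.\<close>

lemma compatible_meet:
  assumes i: "i \<in> I" and f: "\<And>c. c \<in> carrier (Ls i) \<Longrightarrow> f c \<in> carrier (Ls i)"
    and g: "\<And>c. c \<in> carrier (Ls i) \<Longrightarrow> g c \<in> carrier (Ls i)"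
    and h: "\<And>c. c \<in> carrier (Ls i) \<Longrightarrow> h c = f c \<sqinter>\<^bsub>Ls i\<^esub> g c"
    and D: "compatible i f D" and E: "compatible i g E"
  shows "compatible i h (D \<inter> E)"
proof -
  note L = Ls[OF i]
  note m = lattice_meet[OF L] and tr = lattice_le(3)[OF L]
  show ?thesis
    using D
  proof (cases rule: compatible_cases)
    case none
    show ?thesis
    proof (rule compatible_noneI)
      fix c assume c: "c \<in> carrier (Ls i)"
      show "h c \<sqsubseteq>\<^bsub>Ls i\<^esub> c"
        unfolding h[OF c]
        by (rule tr[OF m(1)[OF f[OF c] g[OF c]] f[OF c] c m(2)[OF f[OF c] g[OF c]] none(2)[OF c]])
    qed (use none in auto)
  next
    case D: (principal x c0)
    show ?thesis
      using E
    proof (cases rule: compatible_cases)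
      case none
      show ?thesis
      proof (rule compatible_noneI)
        fix c assume c: "c \<in> carrier (Ls i)"
        show "h c \<sqsubseteq>\<^bsub>Ls i\<^esub> c"
          unfolding h[OF c]
          by (rule tr[OF m(1)[OF f[OF c] g[OF c]] g[OF c] c m(3)[OF f[OF c] g[OF c]] none(2)[OF c]])
      qed (use none in auto)
    next
      case E: (principal y c1)
      show ?thesis
      proof (rule compatible_principalI)
        show "x \<sqinter>\<^bsub>Ls i\<^esub> y \<in> carrier (Ls i)" by (rule m(1)[OF D(1) E(1)])
        show "c0 \<sqinter>\<^bsub>Ls i\<^esub> c1 \<in> carrier (Ls i)" by (rule m(1)[OF D(2) E(2)])
        show "[i \<mapsto> z] \<in> D \<inter> E \<longleftrightarrow> z \<sqsubseteq>\<^bsub>Ls i\<^esub> x \<sqinter>\<^bsub>Ls i\<^esub> y" if z: "z \<in> carrier (Ls i)" for z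
          using D(3)[OF z] E(3)[OF z] m(4)[OF D(1) E(1) z]
            tr[OF z m(1)[OF D(1) E(1)] D(1) _ m(2)[OF D(1) E(1)]]
            tr[OF z m(1)[OF D(1) E(1)] E(1) _ m(3)[OF D(1) E(1)]] by blast
        show "h c = x \<sqinter>\<^bsub>Ls i\<^esub> y" if c: "c \<in> carrier (Ls i)" "c \<sqsubseteq>\<^bsub>Ls i\<^esub> c0 \<sqinter>\<^bsub>Ls i\<^esub> c1" for c
          using h[OF c(1)] D(4)[OF c(1) tr[OF c(1) m(1)[OF D(2) E(2)] D(2) c(2) m(2)[OF D(2) E(2)]]]
            E(4)[OF c(1) tr[OF c(1) m(1)[OF D(2) E(2)] E(2) c(2) m(3)[OF D(2) E(2)]]] by simp
      qed
    qed
  qed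
qed

text \<open>The mixed case explains the condition that \<open>f c\<close> lie below \<open>c\<close>
  when \<open>D\<close> has no element of \<open>Ls i\<close>. If \<open>E\<close> is principal with
  bound \<open>y\<close>, then for \<open>c\<close> below both \<open>y\<close> and the threshold of
  \<open>g\<close>, \<open>f c\<close> is below \<open>c\<close> and so below \<open>y\<close>; it
  is absorbed by \<open>g c = y\<close>.\<close>

lemma compatible_join:
  assumes i: "i \<in> I" and f: "\<And>c. c \<in> carrier (Ls i) \<Longrightarrow> f c \<in> carrier (Ls i)"
    and g: "\<And>c. c \<in> carrier (Ls i) \<Longrightarrow> g c \<in> carrier (Ls i)"
    and h: "\<And>c. c \<in> carrier (Ls i) \<Longrightarrow> h c = f c \<squnion>\<^bsub>Ls i\<^esub> g c"
    and D': "D \<in> fg_downsets" and E': "E \<in> fg_downsets"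
    and D: "compatible i f D" and E: "compatible i g E"
  shows "compatible i h (down_join D E)"
proof -
  note L = Ls[OF i]
  note m = lattice_meet[OF L] and j = lattice_join[OF L] and tr = lattice_le(3)[OF L]
  note s = single_in_down_join[OF D' E']
  show ?thesis
    using D
  proof (cases rule: compatible_cases)
    case D: none
    show ?thesis
      using E
    proof (cases rule: compatible_cases)
      case E: none
      show ?thesis
      proof (rule compatible_noneI)
        fix c assume c: "c \<in> carrier (Ls i)"
        show "h c \<sqsubseteq>\<^bsub>Ls i\<^esub> c"
          unfolding h[OF c] by (rule j(4)[OF f[OF c] g[OF c] c D(2)[OF c] E(2)[OF c]])
      qed (use s D(1) E(1) in auto)
    next
      case E: (principal y c1)
      show ?thesis
      proof (rule compatible_principalI)
        show "y \<in> carrier (Ls i)" "c1 \<sqinter>\<^bsub>Ls i\<^esub> y \<in> carrier (Ls i)" by (rule E(1), rule m(1)[OF E(2,1)])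
        show "h c = y" if c: "c \<in> carrier (Ls i)" "c \<sqsubseteq>\<^bsub>Ls i\<^esub> c1 \<sqinter>\<^bsub>Ls i\<^esub> y" for c
        proof -
          have "c \<sqsubseteq>\<^bsub>Ls i\<^esub> y" by (rule tr[OF c(1) m(1)[OF E(2,1)] E(1) c(2) m(3)[OF E(2,1)]])
          then have "f c \<sqsubseteq>\<^bsub>Ls i\<^esub> y" by (rule tr[OF f[OF c(1)] c(1) E(1) D(2)[OF c(1)]])
          moreover have "g c = y"
            by (rule E(4)[OF c(1) tr[OF c(1) m(1)[OF E(2,1)] E(2) c(2) m(2)[OF E(2,1)]]])
          ultimately show ?thesis
            using h[OF c(1)] join_absorb(1)[OF L f[OF c(1)] E(1)] by simp
        qed
      qed (use s D(1) E(3) in auto)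
    qed
  next
    case D: (principal x c0)
    show ?thesis
      using E
    proof (cases rule: compatible_cases)
      case E: none
      show ?thesis
      proof (rule compatible_principalI)
        show "x \<in> carrier (Ls i)" "c0 \<sqinter>\<^bsub>Ls i\<^esub> x \<in> carrier (Ls i)" by (rule D(1), rule m(1)[OF D(2,1)])
        show "h c = x" if c: "c \<in> carrier (Ls i)" "c \<sqsubseteq>\<^bsub>Ls i\<^esub> c0 \<sqinter>\<^bsub>Ls i\<^esub> x" for c
        proof -
          have "c \<sqsubseteq>\<^bsub>Ls i\<^esub> x" by (rule tr[OF c(1) m(1)[OF D(2,1)] D(1) c(2) m(3)[OF D(2,1)]])
          then have "g c \<sqsubseteq>\<^bsub>Ls i\<^esub> x" by (rule tr[OF g[OF c(1)] c(1) D(1) E(2)[OF c(1)]])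
          moreover have "f c = x"
            by (rule D(4)[OF c(1) tr[OF c(1) m(1)[OF D(2,1)] D(2) c(2) m(2)[OF D(2,1)]]])
          ultimately show ?thesis
            using h[OF c(1)] join_absorb(2)[OF L g[OF c(1)] D(1)] by simp
        qed
      qed (use s E(1) D(3) in auto)
    next
      case E: (principal y c1)
      note xy = D(1) E(1)
      show ?thesis
      proof (rule compatible_principalI)
        show "x \<squnion>\<^bsub>Ls i\<^esub> y \<in> carrier (Ls i)" by (rule j(1)[OF xy])
        show "c0 \<sqinter>\<^bsub>Ls i\<^esub> c1 \<in> carrier (Ls i)" by (rule m(1)[OF D(2) E(2)])
        \<comment> \<open>The elements that \<open>down_join\<close> adds matter here: the union of
          two principal ideals of \<open>Ls i\<close> need not be principal, but its enlargement is
          the ideal of \<open>x \<squnion> y\<close>.\<close>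
        show "[i \<mapsto> z] \<in> down_join D E \<longleftrightarrow> z \<sqsubseteq>\<^bsub>Ls i\<^esub> x \<squnion>\<^bsub>Ls i\<^esub> y" (is "?l \<longleftrightarrow> ?r")
          if z: "z \<in> carrier (Ls i)" for z
        proof
          assume ?r
          moreover have "[i \<mapsto> x] \<in> D" "[i \<mapsto> y] \<in> E"
            using D(3)[OF D(1)] E(3)[OF E(1)] lattice_le(1)[OF L] xy by auto
          ultimately show ?l unfolding s using z by blast
        next
          assume ?l
          then consider "[i \<mapsto> z] \<in> D" | "[i \<mapsto> z] \<in> E"
            | x' y' where "[i \<mapsto> x'] \<in> D" "[i \<mapsto> y'] \<in> E" "z \<sqsubseteq>\<^bsub>Ls i\<^esub> x' \<squnion>\<^bsub>Ls i\<^esub> y'"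
            unfolding s by blast
          then show ?r
          proof cases
            case 1
            then show ?thesis using D(3)[OF z] tr[OF z xy(1) j(1)[OF xy] _ j(2)[OF xy]] by blast
          next
            case 2
            then show ?thesis using E(3)[OF z] tr[OF z xy(2) j(1)[OF xy] _ j(3)[OF xy]] by blast
          next
            case 3
            have c: "x' \<in> carrier (Ls i)" "y' \<in> carrier (Ls i)"
              using single_in_fg_downset[OF D' 3(1)] single_in_fg_downset[OF E' 3(2)] by auto
            have "x' \<sqsubseteq>\<^bsub>Ls i\<^esub> x \<squnion>\<^bsub>Ls i\<^esub> y" "y' \<sqsubseteq>\<^bsub>Ls i\<^esub> x \<squnion>\<^bsub>Ls i\<^esub> y"
              using D(3)[OF c(1)] 3(1) tr[OF c(1) xy(1) j(1)[OF xy] _ j(2)[OF xy]]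
                E(3)[OF c(2)] 3(2) tr[OF c(2) xy(2) j(1)[OF xy] _ j(3)[OF xy]] by blast+
            then have "x' \<squnion>\<^bsub>Ls i\<^esub> y' \<sqsubseteq>\<^bsub>Ls i\<^esub> x \<squnion>\<^bsub>Ls i\<^esub> y"
              by (rule j(4)[OF c j(1)[OF xy]])
            then show ?thesis by (rule tr[OF z j(1)[OF c] j(1)[OF xy] 3(3)])
          qed
        qed
        show "h c = x \<squnion>\<^bsub>Ls i\<^esub> y" if c: "c \<in> carrier (Ls i)" "c \<sqsubseteq>\<^bsub>Ls i\<^esub> c0 \<sqinter>\<^bsub>Ls i\<^esub> c1" for c
          using h[OF c(1)] D(4)[OF c(1) tr[OF c(1) m(1)[OF D(2) E(2)] D(2) c(2) m(2)[OF D(2) E(2)]]]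
            E(4)[OF c(1) tr[OF c(1) m(1)[OF D(2) E(2)] E(2) c(2) m(3)[OF D(2) E(2)]]] by simp
      qed
    qed
  qed
qed

text \<open>If \<open>D\<close> and \<open>E\<close> both contain elements of \<open>Ls i\<close>,
  their principal bounds are both the value of \<open>a\<close> at \<open>(i, c)\<close> for
  \<open>c\<close> below both thresholds. So the bounds coincide, and joins of single elements from
  \<open>D\<close> and \<open>E\<close> are already in \<open>D\<close>.\<close>

lemma down_join_same:
  assumes i: "\<And>i. i \<in> I \<Longrightarrow> compatible i (\<lambda>c. a (i, c)) D" "\<And>i. i \<in> I \<Longrightarrow> compatible i (\<lambda>c. a (i, c)) E"
    and D: "D \<in> fg_downsets" and E: "E \<in> fg_downsets"
  shows "down_join D E = D \<union> E"
proof -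
  have "q \<in> D" if Q: "q \<in> formal_meets" and xy: "[i \<mapsto> x] \<in> D" "[i \<mapsto> y] \<in> E"
    and le: "fm_le q [i \<mapsto> x \<squnion>\<^bsub>Ls i\<^esub> y]" for q i x y
  proof -
    have I: "i \<in> I" and c: "x \<in> carrier (Ls i)" "y \<in> carrier (Ls i)"
      using single_in_fg_downset[OF D xy(1)] single_in_fg_downset[OF E xy(2)] by auto
    note L = Ls[OF I]
    obtain x' c0 where D': "x' \<in> carrier (Ls i)" "c0 \<in> carrier (Ls i)"
      "\<And>y. y \<in> carrier (Ls i) \<Longrightarrow> [i \<mapsto> y] \<in> D \<longleftrightarrow> y \<sqsubseteq>\<^bsub>Ls i\<^esub> x'"
      "\<And>c. \<lbrakk>c \<in> carrier (Ls i); c \<sqsubseteq>\<^bsub>Ls i\<^esub> c0\<rbrakk> \<Longrightarrow> a (i, c) = x'"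
      using i(1)[OF I] xy(1) by (cases rule: compatible_cases) (blast, rule that)
    obtain y' c1 where E': "y' \<in> carrier (Ls i)" "c1 \<in> carrier (Ls i)"
      "\<And>y. y \<in> carrier (Ls i) \<Longrightarrow> [i \<mapsto> y] \<in> E \<longleftrightarrow> y \<sqsubseteq>\<^bsub>Ls i\<^esub> y'"
      "\<And>c. \<lbrakk>c \<in> carrier (Ls i); c \<sqsubseteq>\<^bsub>Ls i\<^esub> c1\<rbrakk> \<Longrightarrow> a (i, c) = y'"
      using i(2)[OF I] xy(2) by (cases rule: compatible_cases) (blast, rule that)
    note m = lattice_meet[OF L D'(2) E'(2)]
    have "x' = y'" using D'(4)[OF m(1,2)] E'(4)[OF m(1,3)] by simp
    then have "x \<squnion>\<^bsub>Ls i\<^esub> y \<sqsubseteq>\<^bsub>Ls i\<^esub> x'"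
      using xy D'(3)[OF c(1)] E'(3)[OF c(2)] lattice_join(4)[OF L c D'(1)] by blast
    then have "[i \<mapsto> x \<squnion>\<^bsub>Ls i\<^esub> y] \<in> D" using D'(3)[OF lattice_join(1)[OF L c]] by simp
    then show "q \<in> D" by (rule fg_downset_closed[OF D _ Q le])
  qed
  then show ?thesis by (auto simp: down_join_def)
qed

section \<open>The lattice of compatible pairs\<close>

definition test_index :: "('i \<times> 'a) set" where
  "test_index = (SIGMA i:I. carrier (Ls i))"

abbreviation test_product :: "('i \<times> 'a \<Rightarrow> 'a) gorder" where
  "test_product \<equiv> direct_product test_index (\<lambda>p. Ls (fst p))"

lemma test_product:
  shows "lattice test_product"
    and "\<lbrakk>a \<in> carrier test_product; b \<in> carrier test_product\<rbrakk> \<Longrightarrow>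
      a \<squnion>\<^bsub>test_product\<^esub> b = (\<lambda>p\<in>test_index. a p \<squnion>\<^bsub>Ls (fst p)\<^esub> b p)"
    and "\<lbrakk>a \<in> carrier test_product; b \<in> carrier test_product\<rbrakk> \<Longrightarrow>
      a \<sqinter>\<^bsub>test_product\<^esub> b = (\<lambda>p\<in>test_index. a p \<sqinter>\<^bsub>Ls (fst p)\<^esub> b p)"
proof -
  have F: "lattice (Ls (fst p))" if "p \<in> test_index" for p
    using that Ls by (auto simp: test_index_def)
  note dp = direct_product_lattice[of test_index "\<lambda>p. Ls (fst p)", OF F]
  show "lattice test_product" by (rule dp(1))
  show "\<lbrakk>a \<in> carrier test_product; b \<in> carrier test_product\<rbrakk> \<Longrightarrow>
      a \<squnion>\<^bsub>test_product\<^esub> b = (\<lambda>p\<in>test_index. a p \<squnion>\<^bsub>Ls (fst p)\<^esub> b p)" by (rule dp(2))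
  show "\<lbrakk>a \<in> carrier test_product; b \<in> carrier test_product\<rbrakk> \<Longrightarrow>
      a \<sqinter>\<^bsub>test_product\<^esub> b = (\<lambda>p\<in>test_index. a p \<sqinter>\<^bsub>Ls (fst p)\<^esub> b p)" by (rule dp(3))
qed

lemma test_product_mem:
  "\<lbrakk>a \<in> carrier test_product; i \<in> I; c \<in> carrier (Ls i)\<rbrakk> \<Longrightarrow> a (i, c) \<in> carrier (Ls i)"
  by (force simp: direct_product_def test_index_def)

definition ext_lattice :: "(('i \<times> 'a \<Rightarrow> 'a) \<times> ('i \<rightharpoonup> 'a) set) gorder" where
  "ext_lattice =
     \<lparr> carrier = {(a, D). a \<in> carrier test_product \<and> D \<in> fg_downsets \<and>
         (\<forall>i\<in>I. compatible i (\<lambda>c. a (i, c)) D)},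
       eq = (=),
       le = (\<lambda>u v. fst u \<sqsubseteq>\<^bsub>test_product\<^esub> fst v \<and> snd u \<subseteq> snd v) \<rparr>"

lemma ext_lattice_carrier:
  "(a, D) \<in> carrier ext_lattice \<longleftrightarrow> a \<in> carrier test_product \<and> D \<in> fg_downsets \<and>
     (\<forall>i\<in>I. compatible i (\<lambda>c. a (i, c)) D)"
  by (simp add: ext_lattice_def)

lemma ext_lattice_le: "(a, D) \<sqsubseteq>\<^bsub>ext_lattice\<^esub> (b, E) \<longleftrightarrow> a \<sqsubseteq>\<^bsub>test_product\<^esub> b \<and> D \<subseteq> E"
  by (simp add: ext_lattice_def)

lemma ext_lattice_closed:
  assumes u: "(a, D) \<in> carrier ext_lattice" and v: "(b, E) \<in> carrier ext_lattice"
  shows "(a \<squnion>\<^bsub>test_product\<^esub> b, down_join D E) \<in> carrier ext_lattice"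
    and "(a \<sqinter>\<^bsub>test_product\<^esub> b, D \<inter> E) \<in> carrier ext_lattice"
proof -
  have a: "a \<in> carrier test_product" and b: "b \<in> carrier test_product"
    and D: "D \<in> fg_downsets" and E: "E \<in> fg_downsets"
    and ca: "\<And>i. i \<in> I \<Longrightarrow> compatible i (\<lambda>c. a (i, c)) D"
    and cb: "\<And>i. i \<in> I \<Longrightarrow> compatible i (\<lambda>c. b (i, c)) E"
    using u v by (simp_all add: ext_lattice_carrier)
  have "compatible i (\<lambda>c. (a \<squnion>\<^bsub>test_product\<^esub> b) (i, c)) (down_join D E)"
    "compatible i (\<lambda>c. (a \<sqinter>\<^bsub>test_product\<^esub> b) (i, c)) (D \<inter> E)" if i: "i \<in> I" for i
  proof -
    note mem = test_product_mem[OF a i] test_product_mem[OF b i]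
    have "(a \<squnion>\<^bsub>test_product\<^esub> b) (i, c) = a (i, c) \<squnion>\<^bsub>Ls i\<^esub> b (i, c)"
      "(a \<sqinter>\<^bsub>test_product\<^esub> b) (i, c) = a (i, c) \<sqinter>\<^bsub>Ls i\<^esub> b (i, c)" if "c \<in> carrier (Ls i)" for c
      unfolding test_product(2,3)[OF a b] using i that by (simp_all add: test_index_def)
    note op = this
    show "compatible i (\<lambda>c. (a \<squnion>\<^bsub>test_product\<^esub> b) (i, c)) (down_join D E)"
      by (rule compatible_join[OF i _ _ _ D E ca[OF i] cb[OF i]]) (simp_all only: mem op)
    show "compatible i (\<lambda>c. (a \<sqinter>\<^bsub>test_product\<^esub> b) (i, c)) (D \<inter> E)"
      by (rule compatible_meet[OF i _ _ _ ca[OF i] cb[OF i]]) (simp_all only: mem op)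
  qed
  then show "(a \<squnion>\<^bsub>test_product\<^esub> b, down_join D E) \<in> carrier ext_lattice"
    "(a \<sqinter>\<^bsub>test_product\<^esub> b, D \<inter> E) \<in> carrier ext_lattice"
    by (simp_all add: ext_lattice_carrier fg_downset_join[OF D E] fg_downset_Int[OF D E]
        lattice_join(1)[OF test_product(1) a b] lattice_meet(1)[OF test_product(1) a b])
qed

text \<open>Compatibility of the upper bound \<open>G\<close> makes its part in \<open>Ls i\<close>
  empty or a principal ideal, hence closed under joins. That is why \<open>down_join\<close> gives
  least upper bounds among compatible pairs.\<close>

lemma down_join_least:
  assumes D: "D \<in> fg_downsets" and E: "E \<in> fg_downsets" and G: "G \<in> fg_downsets"
    and sub: "D \<subseteq> G" "E \<subseteq> G"
    and c: "\<And>i. i \<in> I \<Longrightarrow> compatible i (f i) G"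
  shows "down_join D E \<subseteq> G"
proof -
  have "q \<in> G" if Q: "q \<in> formal_meets" and xy: "[i \<mapsto> x] \<in> D" "[i \<mapsto> y] \<in> E"
    and le: "fm_le q [i \<mapsto> x \<squnion>\<^bsub>Ls i\<^esub> y]" for q i x y
  proof -
    have I: "i \<in> I" and xyc: "x \<in> carrier (Ls i)" "y \<in> carrier (Ls i)"
      using single_in_fg_downset[OF D xy(1)] single_in_fg_downset[OF E xy(2)] by auto
    note L = Ls[OF I]
    have xyG: "[i \<mapsto> x] \<in> G" "[i \<mapsto> y] \<in> G" using xy sub by auto
    obtain z where z: "z \<in> carrier (Ls i)"
      "\<And>y. y \<in> carrier (Ls i) \<Longrightarrow> [i \<mapsto> y] \<in> G \<longleftrightarrow> y \<sqsubseteq>\<^bsub>Ls i\<^esub> z"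
      using c[OF I] xyG(1) by (cases rule: compatible_cases) (blast, rule that)
    have "x \<squnion>\<^bsub>Ls i\<^esub> y \<sqsubseteq>\<^bsub>Ls i\<^esub> z"
      by (rule lattice_join(4)[OF L xyc z(1)]) (use z(2) xyc xyG in blast)+
    then have "[i \<mapsto> x \<squnion>\<^bsub>Ls i\<^esub> y] \<in> G" using z(2)[OF lattice_join(1)[OF L xyc]] by simp
    then show "q \<in> G" by (rule fg_downset_closed[OF G _ Q le])
  qed
  then show ?thesis using sub by (auto simp: down_join_def)
qed

lemma ext_lattice:
  shows "lattice ext_lattice"
    and "\<lbrakk>(a, D) \<in> carrier ext_lattice; (b, E) \<in> carrier ext_lattice\<rbrakk> \<Longrightarrow>
      (a, D) \<squnion>\<^bsub>ext_lattice\<^esub> (b, E) = (a \<squnion>\<^bsub>test_product\<^esub> b, down_join D E)"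
    and "\<lbrakk>(a, D) \<in> carrier ext_lattice; (b, E) \<in> carrier ext_lattice\<rbrakk> \<Longrightarrow>
      (a, D) \<sqinter>\<^bsub>ext_lattice\<^esub> (b, E) = (a \<sqinter>\<^bsub>test_product\<^esub> b, D \<inter> E)"
proof -
  let ?j = "\<lambda>(a, D) (b, E). (a \<squnion>\<^bsub>test_product\<^esub> b, down_join D E)"
    and ?m = "\<lambda>(a, D) (b, E). (a \<sqinter>\<^bsub>test_product\<^esub> b, D \<inter> E)"
  note P = test_product(1)
  note p = lattice_le[OF P] and pj = lattice_join[OF P] and pm = lattice_meet[OF P]
  have eq: "eq ext_lattice = (=)" by (simp add: ext_lattice_def)
  have refl: "u \<sqsubseteq>\<^bsub>ext_lattice\<^esub> u" if "u \<in> carrier ext_lattice" for u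
    using that p(1) by (cases u) (simp add: ext_lattice_le ext_lattice_carrier)
  have antisym: "u = v" if "u \<in> carrier ext_lattice" "v \<in> carrier ext_lattice"
    "u \<sqsubseteq>\<^bsub>ext_lattice\<^esub> v" "v \<sqsubseteq>\<^bsub>ext_lattice\<^esub> u" for u v
    using that p(2)[of "fst u" "fst v"]
    by (cases u; cases v) (auto simp: ext_lattice_le ext_lattice_carrier)
  have trans: "u \<sqsubseteq>\<^bsub>ext_lattice\<^esub> w" if "u \<in> carrier ext_lattice" "v \<in> carrier ext_lattice"
    "w \<in> carrier ext_lattice" "u \<sqsubseteq>\<^bsub>ext_lattice\<^esub> v" "v \<sqsubseteq>\<^bsub>ext_lattice\<^esub> w" for u v w
    using that p(3)[of "fst u" "fst v" "fst w"]
    by (cases u; cases v; cases w) (auto simp: ext_lattice_le ext_lattice_carrier)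
  have j1: "?j u v \<in> carrier ext_lattice \<and> u \<sqsubseteq>\<^bsub>ext_lattice\<^esub> ?j u v \<and> v \<sqsubseteq>\<^bsub>ext_lattice\<^esub> ?j u v"
    if "u \<in> carrier ext_lattice" "v \<in> carrier ext_lattice" for u v
    using that ext_lattice_closed(1)[of "fst u" "snd u" "fst v" "snd v"] pj(2,3)[of "fst u" "fst v"]
    by (cases u; cases v) (auto simp: ext_lattice_le ext_lattice_carrier down_join_def)
  have j2: "?j u v \<sqsubseteq>\<^bsub>ext_lattice\<^esub> w" if "u \<in> carrier ext_lattice" "v \<in> carrier ext_lattice"
    "w \<in> carrier ext_lattice" "u \<sqsubseteq>\<^bsub>ext_lattice\<^esub> w" "v \<sqsubseteq>\<^bsub>ext_lattice\<^esub> w" for u v w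
  proof -
    obtain a D b E c G where uvw: "u = (a, D)" "v = (b, E)" "w = (c, G)"
      by (metis surj_pair)
    show ?thesis
      using that pj(4)[of a b c] down_join_least[of D E G "\<lambda>i x. c (i, x)"]
      by (simp add: uvw ext_lattice_le ext_lattice_carrier)
  qed
  have m1: "?m u v \<in> carrier ext_lattice \<and> ?m u v \<sqsubseteq>\<^bsub>ext_lattice\<^esub> u \<and> ?m u v \<sqsubseteq>\<^bsub>ext_lattice\<^esub> v"
    if "u \<in> carrier ext_lattice" "v \<in> carrier ext_lattice" for u v
    using that ext_lattice_closed(2)[of "fst u" "snd u" "fst v" "snd v"] pm(2,3)[of "fst u" "fst v"]
    by (cases u; cases v) (auto simp: ext_lattice_le ext_lattice_carrier)
  have m2: "w \<sqsubseteq>\<^bsub>ext_lattice\<^esub> ?m u v" if "u \<in> carrier ext_lattice" "v \<in> carrier ext_lattice"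
    "w \<in> carrier ext_lattice" "w \<sqsubseteq>\<^bsub>ext_lattice\<^esub> u" "w \<sqsubseteq>\<^bsub>ext_lattice\<^esub> v" for u v w
    using that pm(4)[of "fst u" "fst v" "fst w"]
    by (cases u; cases v; cases w) (auto simp: ext_lattice_le ext_lattice_carrier)
  note ops = lattice_by_operations[where X = ext_lattice and j = ?j and m = ?m, OF eq]
  show "lattice ext_lattice"
    by (rule ops(1)) ((rule refl antisym trans j1 j2 m1 m2; assumption)+)
  show "(a, D) \<squnion>\<^bsub>ext_lattice\<^esub> (b, E) = (a \<squnion>\<^bsub>test_product\<^esub> b, down_join D E)"
    if "(a, D) \<in> carrier ext_lattice" "(b, E) \<in> carrier ext_lattice"
  proof -
    have "(a, D) \<squnion>\<^bsub>ext_lattice\<^esub> (b, E) = ?j (a, D) (b, E)"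
      by (rule ops(2)) ((rule refl antisym trans j1 j2 m1 m2 that; assumption?)+)
    then show ?thesis by simp
  qed
  show "(a, D) \<sqinter>\<^bsub>ext_lattice\<^esub> (b, E) = (a \<sqinter>\<^bsub>test_product\<^esub> b, D \<inter> E)"
    if "(a, D) \<in> carrier ext_lattice" "(b, E) \<in> carrier ext_lattice"
  proof -
    have "(a, D) \<sqinter>\<^bsub>ext_lattice\<^esub> (b, E) = ?m (a, D) (b, E)"
      by (rule ops(3)) ((rule refl antisym trans j1 j2 m1 m2 that; assumption?)+)
    then show ?thesis by simp
  qed
qed

text \<open>This projection becomes the homomorphism onto the \<open>V\<close>-part required by the
  class composition.\<close>

lemma fst_lattice_hom: "lattice_hom ext_lattice test_product fst"
proof (rule lattice_homI[OF ext_lattice(1) test_product(1)])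
  fix u v assume u: "u \<in> carrier ext_lattice"
  obtain a D where uu: "u = (a, D)" by (rule prod.exhaust)
  show "fst u \<in> carrier test_product" using u by (simp add: uu ext_lattice_carrier)
  assume v: "v \<in> carrier ext_lattice"
  obtain b E where vv: "v = (b, E)" by (rule prod.exhaust)
  show "fst (u \<squnion>\<^bsub>ext_lattice\<^esub> v) = fst u \<squnion>\<^bsub>test_product\<^esub> fst v"
    "fst (u \<sqinter>\<^bsub>ext_lattice\<^esub> v) = fst u \<sqinter>\<^bsub>test_product\<^esub> fst v"
    using u v by (simp_all add: uu vv ext_lattice(2,3))
qed

text \<open>By \<open>down_join_same\<close>, the second components in a fiber are joined by union
  and met by intersection, so distributivity is inherited from sets.\<close>

lemma ext_lattice_fiber_distrib:
  assumes u: "u \<in> carrier ext_lattice" "v \<in> carrier ext_lattice" "w \<in> carrier ext_lattice"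
    and eq: "fst u = fst v" "fst u = fst w"
  shows "u \<sqinter>\<^bsub>ext_lattice\<^esub> (v \<squnion>\<^bsub>ext_lattice\<^esub> w) =
    (u \<sqinter>\<^bsub>ext_lattice\<^esub> v) \<squnion>\<^bsub>ext_lattice\<^esub> (u \<sqinter>\<^bsub>ext_lattice\<^esub> w)"
proof -
  obtain a D E G where e: "u = (a, D)" "v = (a, E)" "w = (a, G)"
    using eq by (metis prod.collapse)
  note c = u[unfolded e]
  have a: "a \<in> carrier test_product" using c(1) by (simp add: ext_lattice_carrier)
  have same: "down_join X Y = X \<union> Y"
    if "(a, X) \<in> carrier ext_lattice" "(a, Y) \<in> carrier ext_lattice" for X Y
    by (rule down_join_same[where a = a]) (use that in \<open>simp_all add: ext_lattice_carrier\<close>)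
  have "a \<sqinter>\<^bsub>test_product\<^esub> a = a" "a \<squnion>\<^bsub>test_product\<^esub> a = a"
    using a meet_idem[OF test_product(1)] join_idem[OF test_product(1)] by auto
  \<comment> \<open>Idempotence in the product keeps these pairs in the same fiber, so that
    \<open>down_join_same\<close> applies to them too.\<close>
  moreover from this have "(a, D \<inter> E) \<in> carrier ext_lattice" "(a, D \<inter> G) \<in> carrier ext_lattice"
    "(a, E \<union> G) \<in> carrier ext_lattice"
    using ext_lattice_closed(2)[OF c(1,2)] ext_lattice_closed(2)[OF c(1,3)]
      ext_lattice_closed(1)[OF c(2,3)] same[OF c(2,3)] by auto
  ultimately show ?thesis
    using c by (simp add: e ext_lattice(2,3) same Int_Un_distrib)
qed

lemma down_eval_join_hom: "join_hom ext_lattice M (\<lambda>u. down_eval (snd u))"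
proof (rule join_homI[OF ext_lattice(1) M])
  fix u v assume u: "u \<in> carrier ext_lattice"
  obtain a D where uu: "u = (a, D)" by (rule prod.exhaust)
  show "down_eval (snd u) \<in> carrier M" using u down_eval(1) by (simp add: uu ext_lattice_carrier)
  assume v: "v \<in> carrier ext_lattice"
  obtain b E where vv: "v = (b, E)" by (rule prod.exhaust)
  show "down_eval (snd (u \<squnion>\<^bsub>ext_lattice\<^esub> v)) = down_eval (snd u) \<squnion>\<^bsub>M\<^esub> down_eval (snd v)"
    using u v by (simp add: uu vv ext_lattice(2)) (simp add: ext_lattice_carrier down_eval_join)
qed

section \<open>The canonical maps into the lattice of pairs\<close>

definition inject :: "'i \<Rightarrow> 'a \<Rightarrow> ('i \<times> 'a \<Rightarrow> 'a) \<times> ('i \<rightharpoonup> 'a) set" where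
  "inject i x = ((\<lambda>(j, c)\<in>test_index. if j = i then x else c), down {[i \<mapsto> x]})"

lemma single_in_down_single:
  assumes "i \<in> I" "x \<in> carrier (Ls i)"
  shows "[j \<mapsto> y] \<in> down {[i \<mapsto> x]} \<longleftrightarrow> j = i \<and> y \<in> carrier (Ls i) \<and> y \<sqsubseteq>\<^bsub>Ls i\<^esub> x"
  using assms by (cases "j = i") (simp_all add: down_def fm_le_single)

lemma inject_carrier:
  assumes i: "i \<in> I" and x: "x \<in> carrier (Ls i)"
  shows "inject i x \<in> carrier ext_lattice"
proof -
  let ?a = "\<lambda>(j, c)\<in>test_index. if j = i then x else c"
  have "?a \<in> carrier test_product"
    using x by (auto simp: direct_product_def test_index_def)
  moreover have "down {[i \<mapsto> x]} \<in> fg_downsets"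
    by (rule fg_downsetsI) (use i x in auto)
  moreover have "compatible j (\<lambda>c. ?a (j, c)) (down {[i \<mapsto> x]})" if j: "j \<in> I" for j
  proof (cases "j = i")
    case True
    show ?thesis
      unfolding True
      \<comment> \<open>The family is constantly \<open>x\<close>, so any element can be the
        threshold; \<open>x\<close> itself is at hand.\<close>
      by (rule compatible_principalI[OF x x])
        (use i x in \<open>simp_all add: single_in_down_single test_index_def\<close>)
  next
    case False
    show ?thesis
      \<comment> \<open>Here the coordinate \<open>(j, c)\<close> has the value \<open>c\<close>,
        the extreme case of lying below \<open>c\<close>.\<close>
      by (rule compatible_noneI)
        (use False i j x lattice_le(1)[OF Ls[OF j]] in \<open>simp_all add: single_in_down_single test_index_def\<close>)
  qed
  ultimately show ?thesis by (simp add: inject_def ext_lattice_carrier)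
qed

text \<open>For joins the first components agree coordinatewise by idempotence. In the second, the
  principal downset of \<open>x \<squnion> y\<close> can exceed the union of those of
  \<open>x\<close> and \<open>y\<close>; the elements added by \<open>down_join\<close> make up the
  difference.\<close>

lemma inject_lattice_hom:
  assumes i: "i \<in> I"
  shows "lattice_hom (Ls i) ext_lattice (inject i)"
proof (rule lattice_homI[OF Ls[OF i] ext_lattice(1) inject_carrier[OF i]])
  fix x y assume x: "x \<in> carrier (Ls i)" and y: "y \<in> carrier (Ls i)"
  note L = Ls[OF i]
  note j = lattice_join[OF L x y] and m = lattice_meet[OF L x y] and tr = lattice_le(3)[OF L]
  let ?a = "\<lambda>x. \<lambda>(j, c)\<in>test_index. if j = i then x else c"
  have X: "(?a x, down {[i \<mapsto> x]}) \<in> carrier ext_lattice"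
    and Y: "(?a y, down {[i \<mapsto> y]}) \<in> carrier ext_lattice"
    using inject_carrier[OF i x] inject_carrier[OF i y] by (simp_all add: inject_def)
  then have a: "?a x \<in> carrier test_product" "?a y \<in> carrier test_product"
    by (simp_all add: ext_lattice_carrier)
  have idem: "c \<squnion>\<^bsub>Ls j\<^esub> c = c" "c \<sqinter>\<^bsub>Ls j\<^esub> c = c" if "(j, c) \<in> test_index" for j c
    using that join_idem[OF Ls] meet_idem[OF Ls] by (auto simp: test_index_def)
  have aj: "?a (x \<squnion>\<^bsub>Ls i\<^esub> y) = ?a x \<squnion>\<^bsub>test_product\<^esub> ?a y"
    and am: "?a (x \<sqinter>\<^bsub>Ls i\<^esub> y) = ?a x \<sqinter>\<^bsub>test_product\<^esub> ?a y"
    unfolding test_product(2,3)[OF a] by (auto simp: fun_eq_iff idem)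
  have mono: "fm_le q [i \<mapsto> w]" if Q: "q \<in> formal_meets" and "fm_le q [i \<mapsto> z]" "z \<sqsubseteq>\<^bsub>Ls i\<^esub> w"
    "z \<in> carrier (Ls i)" "w \<in> carrier (Ls i)" for q z w
    by (rule fm_le_trans[OF Q _ _ that(2)]) (use that i in \<open>simp_all add: fm_le_single\<close>)
  have "[i \<mapsto> x] \<in> down {[i \<mapsto> x]}" "[i \<mapsto> y] \<in> down {[i \<mapsto> y]}"
    using i x y by (auto intro!: generator_in_down)
  then have "down {[i \<mapsto> x \<squnion>\<^bsub>Ls i\<^esub> y]} \<subseteq> down_join (down {[i \<mapsto> x]}) (down {[i \<mapsto> y]})"
    unfolding down_join_def by (auto simp: down_def)
  moreover have "down_join (down {[i \<mapsto> x]}) (down {[i \<mapsto> y]}) \<subseteq> down {[i \<mapsto> x \<squnion>\<^bsub>Ls i\<^esub> y]}"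
  proof
    fix q assume q: "q \<in> down_join (down {[i \<mapsto> x]}) (down {[i \<mapsto> y]})"
    then have Q: "q \<in> formal_meets" by (auto simp: down_join_def down_def)
    have "fm_le q [i \<mapsto> x \<squnion>\<^bsub>Ls i\<^esub> y]"
    proof (cases "q \<in> down {[i \<mapsto> x]} \<union> down {[i \<mapsto> y]}")
      case True
      then show ?thesis using mono[OF Q _ j(2) x j(1)] mono[OF Q _ j(3) y j(1)] by (auto simp: down_def)
    next
      case False
      then obtain k x' y' where *: "[k \<mapsto> x'] \<in> down {[i \<mapsto> x]}" "[k \<mapsto> y'] \<in> down {[i \<mapsto> y]}"
        "fm_le q [k \<mapsto> x' \<squnion>\<^bsub>Ls k\<^esub> y']"
        using q by (auto simp: down_join_def)
      \<comment> \<open>The downset of \<open>[i \<mapsto> x]\<close> contains single elements of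
        \<open>Ls i\<close> only, so the extra joins are taken in \<open>Ls i\<close> as
        well.\<close>
      then have k: "k = i" and x': "x' \<in> carrier (Ls i)" "x' \<sqsubseteq>\<^bsub>Ls i\<^esub> x"
        and y': "y' \<in> carrier (Ls i)" "y' \<sqsubseteq>\<^bsub>Ls i\<^esub> y"
        using single_in_down_single[OF i x] single_in_down_single[OF i y] by blast+
      have "x' \<squnion>\<^bsub>Ls i\<^esub> y' \<sqsubseteq>\<^bsub>Ls i\<^esub> x \<squnion>\<^bsub>Ls i\<^esub> y"
        by (rule lattice_join(4)[OF L x'(1) y'(1) j(1) tr[OF x'(1) x j(1) x'(2) j(2)]
              tr[OF y'(1) y j(1) y'(2) j(3)]])
      then show ?thesis
        using mono[OF Q *(3)[unfolded k] _ lattice_join(1)[OF L x'(1) y'(1)] j(1)] by blast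
    qed
    then show "q \<in> down {[i \<mapsto> x \<squnion>\<^bsub>Ls i\<^esub> y]}" using Q by (simp add: down_def)
  qed
  ultimately have dj: "down {[i \<mapsto> x \<squnion>\<^bsub>Ls i\<^esub> y]} = down_join (down {[i \<mapsto> x]}) (down {[i \<mapsto> y]})"
    by (rule subset_antisym)
  show "inject i (x \<squnion>\<^bsub>Ls i\<^esub> y) = inject i x \<squnion>\<^bsub>ext_lattice\<^esub> inject i y"
    unfolding inject_def ext_lattice(2)[OF X Y] by (simp only: aj dj)
  have "fm_le q [i \<mapsto> x \<sqinter>\<^bsub>Ls i\<^esub> y]" if Q: "q \<in> formal_meets" and xy: "fm_le q [i \<mapsto> x]" "fm_le q [i \<mapsto> y]" for q
  proof -
    obtain z where z: "q i = Some z" "z \<sqsubseteq>\<^bsub>Ls i\<^esub> x" "z \<sqsubseteq>\<^bsub>Ls i\<^esub> y"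
      using xy by (auto simp: fm_le_single)
    then show ?thesis
      using lattice_meet(4)[OF L x y _ z(2,3)] formal_meetsD[OF Q z(1)] by (simp add: fm_le_single)
  qed
  then have dm: "down {[i \<mapsto> x \<sqinter>\<^bsub>Ls i\<^esub> y]} = down {[i \<mapsto> x]} \<inter> down {[i \<mapsto> y]}"
    using mono[OF _ _ m(2) m(1) x] mono[OF _ _ m(3) m(1) y] by (auto simp: down_def)
  show "inject i (x \<sqinter>\<^bsub>Ls i\<^esub> y) = inject i x \<sqinter>\<^bsub>ext_lattice\<^esub> inject i y"
    unfolding inject_def ext_lattice(3)[OF X Y] by (simp only: am dm)
qed

text \<open>The formal meet \<open>[i \<mapsto> x]\<close> is the greatest element of its downset,
  so the supremum is its value.\<close>

lemma down_eval_inject: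
  assumes i: "i \<in> I" and x: "x \<in> carrier (Ls i)"
  shows "down_eval (snd (inject i x)) = \<phi>s i x"
proof -
  have Q: "[i \<mapsto> x] \<in> formal_meets" using i x by simp
  have D: "down {[i \<mapsto> x]} \<in> fg_downsets" by (rule fg_downsetsI) (use Q in auto)
  have c: "\<phi>s i x \<in> carrier M" by (rule join_homD(3)[OF \<phi>s[OF i] x])
  have "down_eval (down {[i \<mapsto> x]}) \<sqsubseteq>\<^bsub>M\<^esub> \<phi>s i x"
    by (rule down_eval(3)[OF D c])
      (use fm_eval_mono[OF _ Q] fm_eval_single[OF i x] in \<open>auto simp: down_def\<close>)
  moreover have "\<phi>s i x \<sqsubseteq>\<^bsub>M\<^esub> down_eval (down {[i \<mapsto> x]})"
    using down_eval(2)[OF D generator_in_down[of "{[i \<mapsto> x]}" "[i \<mapsto> x]"]] Q fm_eval_single[OF i x] by simp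
  ultimately show ?thesis
    using lattice_le(2)[OF M down_eval(1)[OF D] c] by (simp add: inject_def)
qed

end

section \<open>Free products\<close>

lemma free_product_inE:
  assumes "free_product_in W I Ls L \<eta>" "N \<in> W" "\<And>i. i \<in> I \<Longrightarrow> lattice_hom (Ls i) N (\<psi> i)"
  obtains h where "lattice_hom L N h" "\<And>i x. \<lbrakk>i \<in> I; x \<in> carrier (Ls i)\<rbrakk> \<Longrightarrow> h (\<eta> i x) = \<psi> i x"
proof -
  have "\<exists>!h. h \<in> extensional (carrier L) \<and> lattice_hom L N h \<and>
      (\<forall>i\<in>I. \<forall>x\<in>carrier (Ls i). h (\<eta> i x) = \<psi> i x)"
    using assms(1)[unfolded free_product_in_def, THEN conjunct2, THEN conjunct2,
        rule_format, OF assms(2,3)] .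
  then obtain h where "lattice_hom L N h" "\<forall>i\<in>I. \<forall>x\<in>carrier (Ls i). h (\<eta> i x) = \<psi> i x"
    by (elim ex1E conjE)
  then show thesis using that by blast
qed

text \<open>
  Test lattices: a two-element one separates distinct indices; \<open>L\<^sub>i\<close> itself, with constant maps from the
  other \<open>L\<^sub>k\<close>, separates points of \<open>L\<^sub>i\<close>.
\<close>

lemma free_product_injective:
  fixes V :: "'u gorder set"
  assumes inf: "infinite (UNIV :: 'u set)" and V: "prevariety V"
    and Ls: "\<And>i. i \<in> I \<Longrightarrow> Ls i \<in> V"
    and L: "free_product_in (class_comp distributive_lattices V) I Ls L \<eta>"
    and i: "i \<in> I" "x \<in> carrier (Ls i)" and j: "j \<in> I" "y \<in> carrier (Ls j)"
    and eq: "\<eta> i x = \<eta> j y"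
  shows "i = j \<and> x = y"
proof -
  let ?W = "class_comp distributive_lattices V"
  have NE: "nonempty_lattice (Ls k)" if "k \<in> I" for k
    using V Ls[OF that] by (simp add: prevariety_def)
  have LL: "lattice (Ls k)" if "k \<in> I" for k
    using NE[OF that] by (simp add: nonempty_lattice_def)
  have univ: "\<psi> i x = \<psi> j y"
    if N: "N \<in> ?W" "\<And>k. k \<in> I \<Longrightarrow> lattice_hom (Ls k) N (\<psi> k)" for N \<psi>
  proof -
    obtain h where "\<And>k x. \<lbrakk>k \<in> I; x \<in> carrier (Ls k)\<rbrakk> \<Longrightarrow> h (\<eta> k x) = \<psi> k x"
      using free_product_inE[OF L N] by metis
    from this[OF i] this[OF j] show ?thesis using eq by simp
  qed
  have "i = j"
  proof (rule ccontr)
    assume "i \<noteq> j"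
    let ?B = "\<lparr>carrier = UNIV, eq = (=), le = (\<le>)\<rparr> :: bool gorder"
    have ops: "lattice ?B" "\<And>p q. p \<squnion>\<^bsub>?B\<^esub> q = (p \<or> q)" "\<And>p q. p \<sqinter>\<^bsub>?B\<^esub> q = (p \<and> q)"
      by (rule lattice_by_operations[of ?B "(\<or>)" "(\<and>)"]; auto)+
    \<comment> \<open>The empty product is a point, so all of \<open>?B\<close> is one fiber. As
      \<open>?B\<close> is distributive, its copy lies in the class whatever \<open>V\<close>
      is.\<close>
    let ?P = "direct_product {} (\<lambda>_. Ls i)"
    have P: "lattice ?P" "(\<lambda>_. undefined) \<in> carrier ?P"
      by (rule direct_product_lattice) (simp_all add: direct_product_def)
    obtain c :: "nat \<Rightarrow> 'u" where c: "inj c"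
      using inf by (auto simp: infinite_iff_countable_subset)
    define e where "e b = (if b then c 1 else c 0)" for b
    have e: "inj e" by (rule injI) (use c in \<open>auto simp: e_def inj_eq split: if_splits\<close>)
    have "image_order ?B e \<in> ?W"
      by (rule class_comp_image_order[OF V _ _ lattice_hom_const[OF ops(1) P]])
        (use e in \<open>auto simp: nonempty_lattice_def ops\<close>)
    moreover have "lattice_hom (Ls k) (image_order ?B e) (\<lambda>_. e (k = i))" if "k \<in> I" for k
      by (rule lattice_hom_const[OF LL[OF that]])
        (use lattice_homD(2)[OF image_order_iso(1)[OF ops(1)]] e in auto)
    ultimately have "e (i = i) = e (j = i)" by (rule univ)
    then show False using e \<open>i \<noteq> j\<close> by (auto dest: injD)
  qed
  moreover have "x = y"
  proof -
    \<comment> \<open>The map to the product with the single factor \<open>Ls i\<close> is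
      injective; its fibers are points, where distributivity is trivial.\<close>
    let ?P = "direct_product {i} Ls" and ?\<epsilon> = "\<lambda>z. \<lambda>k\<in>{i}. z"
    have hom: "lattice_hom (Ls i) ?P ?\<epsilon>"
      using lattice_hom_product_iff[where J = "{i}" and F = Ls and N = "Ls i" and h = ?\<epsilon>] LL i
      by (auto intro: lattice_homI)
    have inj: "z = w" if "?\<epsilon> z = ?\<epsilon> w" for z w using fun_cong[OF that, of i] by simp
    let ?N = "image_order (Ls i) (\<lambda>z. z)"
    have "?N \<in> ?W"
    proof (rule class_comp_image_order[OF V NE[OF i(1)] _ hom])
      show "Ls k \<in> V" if "k \<in> {i}" for k using that Ls i(1) by simp
      fix u v w assume c: "u \<in> carrier (Ls i)" and "?\<epsilon> u = ?\<epsilon> v" "?\<epsilon> u = ?\<epsilon> w"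
      then have "v = u" "w = u" using inj by metis+
      then show "u \<sqinter>\<^bsub>Ls i\<^esub> (v \<squnion>\<^bsub>Ls i\<^esub> w) = (u \<sqinter>\<^bsub>Ls i\<^esub> v) \<squnion>\<^bsub>Ls i\<^esub> (u \<sqinter>\<^bsub>Ls i\<^esub> w)"
        using join_idem[OF LL[OF i(1)] c] meet_idem[OF LL[OF i(1)] c] by simp
    qed simp
    moreover have "lattice_hom (Ls k) ?N (if k = i then (\<lambda>z. z) else (\<lambda>_. x))" if "k \<in> I" for k
    proof -
      have iso: "lattice_hom (Ls i) ?N (\<lambda>z. z)"
        by (rule image_order_iso(1)[OF LL[OF i(1)]]) simp
      have "lattice_hom (Ls k) ?N (\<lambda>_. x)"
        by (rule lattice_hom_const[OF LL[OF that] lattice_homD(2)[OF iso]]) (simp add: i(2))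
      with iso show ?thesis by simp
    qed
    ultimately have "(if i = i then (\<lambda>z. z) else (\<lambda>_. x)) x = (if j = i then (\<lambda>z. z) else (\<lambda>_. x)) y"
      by (rule univ)
    then show ?thesis using \<open>i = j\<close> by simp
  qed
  ultimately show ?thesis by simp
qed

theorem theorem14:
  fixes V :: "'u gorder set"
    and I :: "'i set"
    and Ls :: "'i \<Rightarrow> 'u gorder"
    and M :: "'m gorder"
    and \<phi>s :: "'i \<Rightarrow> 'u \<Rightarrow> 'm"
    and L :: "'u gorder"
    and \<eta> :: "'i \<Rightarrow> 'u \<Rightarrow> 'u"
  assumes "infinite (UNIV :: 'u set)"
    and "prevariety V"
    and "\<And>i. i \<in> I \<Longrightarrow> Ls i \<in> V"
    and "nonempty_lattice M"
    and "\<And>i. i \<in> I \<Longrightarrow> join_hom (Ls i) M (\<phi>s i)"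
    and "free_product_in (class_comp distributive_lattices V) I Ls L \<eta>"
  shows "\<exists>\<phi>. join_hom L M \<phi> \<and> (\<forall>i\<in>I. \<forall>x\<in>carrier (Ls i). \<phi> (\<eta> i x) = \<phi>s i x)"
proof (cases "I = {}")
  case True
  \<comment> \<open>For an empty family there is nothing to extend, and a constant map preserves
    joins.\<close>
  obtain m where m: "m \<in> carrier M" using assms(4) by (auto simp: nonempty_lattice_def)
  have "lattice L" using assms(6) by (simp add: free_product_in_def class_comp_def nonempty_lattice_def)
  then have "join_hom L M (\<lambda>_. m)"
    using assms(4) m by (intro join_homI) (auto simp: nonempty_lattice_def join_idem)
  then show ?thesis using True by blast
next
  case False
  let ?W = "class_comp distributive_lattices V"
  have NE: "nonempty_lattice (Ls i)" if "i \<in> I" for i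
    using assms(2) assms(3)[OF that] by (simp add: prevariety_def)
  interpret join_hom_family I Ls M \<phi>s
    by (rule join_hom_family.intro) (use NE assms(4,5) in \<open>simp_all add: nonempty_lattice_def\<close>)
  let ?N = ext_lattice
  obtain i0 x0 where i0: "i0 \<in> I" "x0 \<in> carrier (Ls i0)"
    using False NE by (fastforce simp: nonempty_lattice_def)
  \<comment> \<open>The elements \<open>inject i x\<close> have to be enumerated by the universe.
    Since \<open>\<eta> i x\<close> determines \<open>i\<close> and \<open>x\<close>, it can serve
    as the index of \<open>inject i x\<close>; an element outside all the images gets the default
    \<open>inject i0 x0\<close>.\<close>
  define R where "R u p \<longleftrightarrow> fst p \<in> I \<and> snd p \<in> carrier (Ls (fst p)) \<and> \<eta> (fst p) (snd p) = u" for u p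
  define g where "g u = (if \<exists>p. R u p then case_prod inject (SOME p. R u p) else inject i0 x0)" for u
  have g_eta: "g (\<eta> i x) = inject i x" if ix: "i \<in> I" "x \<in> carrier (Ls i)" for i x
  proof -
    have R: "R (\<eta> i x) (i, x)" using ix by (simp add: R_def)
    then have S: "R (\<eta> i x) (SOME p. R (\<eta> i x) p)" by (rule someI)
    have "(SOME p. R (\<eta> i x) p) = (i, x)"
      using free_product_injective[OF assms(1,2,3,6), of "fst (SOME p. R (\<eta> i x) p)" "snd (SOME p. R (\<eta> i x) p)" i x]
        S ix unfolding R_def[of _ "SOME p. R (\<eta> i x) p"] by (auto simp: prod_eq_iff)
    then show ?thesis using R by (auto simp: g_def)
  qed
  have gN: "g u \<in> carrier ?N" for u
  proof (cases "\<exists>i\<in>I. \<exists>x\<in>carrier (Ls i). u = \<eta> i x")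
    case True
    then show ?thesis using g_eta inject_carrier by auto
  next
    case False
    then have "g u = inject i0 x0" by (auto simp: g_def R_def)
    then show ?thesis using inject_carrier i0 by simp
  qed
  \<comment> \<open>The universal property speaks of lattices on \<open>'u\<close> only. The full
    lattice of pairs may be too large, but a sublattice containing all \<open>inject i x\<close> has
    a copy there.\<close>
  obtain S and e :: "_ \<Rightarrow> 'u" where S: "lattice_closed ?N S" "range g \<subseteq> S" "inj_on e S"
    by (rule generated_sublattice[OF assms(1) ext_lattice(1) gN])
  let ?S = "?N\<lparr>carrier := S\<rparr>"
  note sub = sublattice[OF ext_lattice(1) S(1)]
    and sub_hom = lattice_hom_sublattice[OF ext_lattice(1) S(1)]
  have inj: "inj_on e (carrier ?S)" using S(3) by simp
  note iso = image_order_iso[OF sub(1) inj]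
  let ?Y = "image_order ?S e"
  have Y: "?Y \<in> ?W"
  proof (rule class_comp_image_order[OF assms(2) _ _ lattice_hom_comp[OF sub_hom(1) fst_lattice_hom] _ inj])
    show "nonempty_lattice ?S" using sub(1) S(2) by (auto simp: nonempty_lattice_def)
    show "Ls (fst p) \<in> V" if "p \<in> test_index" for p
      using that assms(3) by (auto simp: test_index_def)
    show "u \<sqinter>\<^bsub>?S\<^esub> (v \<squnion>\<^bsub>?S\<^esub> w) = (u \<sqinter>\<^bsub>?S\<^esub> v) \<squnion>\<^bsub>?S\<^esub> (u \<sqinter>\<^bsub>?S\<^esub> w)"
      if "u \<in> carrier ?S" "v \<in> carrier ?S" "w \<in> carrier ?S" "fst u = fst v" "fst u = fst w" for u v w
      using that S(1) ext_lattice_fiber_distrib[of u v w] by (auto simp: sub lattice_closed_def)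
  qed
  have "lattice_hom (Ls i) ?Y (\<lambda>x. e (inject i x))" if i: "i \<in> I" for i
  proof (rule lattice_hom_comp[OF sub_hom(2)[OF inject_lattice_hom[OF i]] iso(1)])
    show "inject i x \<in> S" if "x \<in> carrier (Ls i)" for x
      using g_eta[OF i that] S(2) by (metis range_subsetD)
  qed
  then obtain h where h: "lattice_hom L ?Y h"
    "\<And>i x. \<lbrakk>i \<in> I; x \<in> carrier (Ls i)\<rbrakk> \<Longrightarrow> h (\<eta> i x) = e (inject i x)"
    using free_product_inE[OF assms(6) Y, where \<psi> = "\<lambda>i x. e (inject i x)"] by metis
  \<comment> \<open>Undoing the coding turns \<open>h\<close> into a homomorphism from
    \<open>L\<close> to the lattice of pairs that sends \<open>\<eta> i x\<close> to
    \<open>inject i x\<close>; evaluating its second component in \<open>M\<close> gives the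
    required map.\<close>
  define k where "k u = inv_into (carrier ?S) e (h u)" for u
  have k: "lattice_hom L ?N k"
    unfolding k_def by (rule lattice_hom_comp[OF lattice_hom_comp[OF h(1) iso(2)] sub_hom(1)])
  let ?\<phi> = "\<lambda>u. down_eval (snd (k u))"
  have "join_hom L M ?\<phi>"
    by (rule join_homI)
      (simp_all add: lattice_homD[OF k] join_homD(3,4)[OF down_eval_join_hom] M)
  moreover have "?\<phi> (\<eta> i x) = \<phi>s i x" if ix: "i \<in> I" "x \<in> carrier (Ls i)" for i x
  proof -
    have "inject i x \<in> S" using g_eta[OF ix] S(2) by (metis range_subsetD)
    then have "k (\<eta> i x) = inject i x"
      using S(3) by (simp add: k_def h(2)[OF ix])
    then show ?thesis by (simp add: down_eval_inject[OF ix])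
  qed
  ultimately show ?thesis by blast
qed

end
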